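(* Let $p\in(1,\infty)$ and $t\in(0,1)$. Let $f$ be the function on the unit circle $\mathbb{T}$ formally associated to the Fourier series $$f(x)\sim\sum_{\nu=1}^{\infty}\nu^{-t-1+\frac1p}\cos(\nu x),\qquad x\in\mathbb{T}.$$ Then $f\in L^p(\mathbb{T})$ but $f\notin H^{t,p}(\mathbb{T})$. Furthermore, given any sequence $(s_k)_{k\in\mathbb{N}}\subset(0,t)$ with $s_k\uparrow t$, $$\sup_{k\in\mathbb{N}}\,(t-s_k)^{\frac1p}\,\|f\|_{\dot W^{s_k,p}(\mathbb{T})}<\infty .$$
   Context: $\mathbb{T}$ is the unit circle, identified with $\mathbb{R}/2\pi\mathbb{Z}$; functions on $\mathbb{T}$ are viewed as $2\pi$-periodic functions. Spaces of periodic functions are defined as their analogues on $\mathbb{R}^n$, with $L^p(\mathbb{R}^n)$ replaced by $L^p(\mathbb{T})$. Thus, for $s\in(0,1)$, the Gagliardo seminorm is $$\|f\|_{\dot W^{s,p}(\mathbb{T})}=\Big(\int_{\mathbb{R}}\int_{\mathbb{T}}\frac{|f(x+h)-f(x)|^p}{|h|^{sp+1}}\,dx\,dh\Big)^{1/p},$$ and $H^{t,p}(\mathbb{T})$ is the space of those $f\in L^p(\mathbb{T})$ such that $(-\Delta)^{t/2}f\in L^p(\mathbb{T})$, where $(-\Delta)^{t/2}$ is the Fourier multiplier operator multiplying the $\nu$-th Fourier coefficient by $|\nu|^t$. *)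

theory Defs
  imports "HOL-Analysis.Analysis"
begin

text \<open>
  The circle is \<open>\<real> / 2\<pi>\<int>\<close> with Lebesgue measure of total mass \<open>2\<pi>\<close>. Elements of the
  function spaces are (not necessarily continuous) periodic representatives; functions that
  agree almost everywhere are not identified, but all the notions below are invariant under
  changing a function on a null set.
\<close>

abbreviation circle_measure :: "real measure" where
  "circle_measure \<equiv> lebesgue_on {0..2*pi}"

definition periodic_2pi :: "(real \<Rightarrow> complex) \<Rightarrow> bool" where
  "periodic_2pi f \<longleftrightarrow> (\<forall>x. f (x + 2*pi) = f x)"

definition Lp_circle :: "real \<Rightarrow> (real \<Rightarrow> complex) set" where
  "Lp_circle p = {f. periodic_2pi f \<and> f \<in> borel_measurable lebesgue \<and>
                     integrable circle_measure (\<lambda>x. norm (f x) powr p)}"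

definition fourier_coeff :: "(real \<Rightarrow> complex) \<Rightarrow> int \<Rightarrow> complex" where
  "fourier_coeff f \<nu> =
     (\<integral>x. f x * cis (- (of_int \<nu> * x)) \<partial>circle_measure) / of_real (2*pi)"

text \<open>
  \<open>f\<close> is the integrable function formally associated to \<open>\<Sum>\<nu>\<ge>1. a \<nu> * cos (\<nu> x)\<close>.
  Since \<open>cos (\<nu> x) = (cis (\<nu> x) + cis (- \<nu> x)) / 2\<close>, the Fourier coefficients at \<open>\<nu>\<close> and
  \<open>-\<nu>\<close> are both \<open>a \<nu> / 2\<close>. No convergence of the series is asserted.
\<close>

definition has_cosine_series :: "(real \<Rightarrow> complex) \<Rightarrow> (nat \<Rightarrow> real) \<Rightarrow> bool" where
  "has_cosine_series f a \<longleftrightarrow> f \<in> Lp_circle 1 \<and>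
     (\<forall>\<nu>. fourier_coeff f \<nu> = (if \<nu> = 0 then 0 else of_real (a (nat \<bar>\<nu>\<bar>) / 2)))"

text \<open>
  \<open>g = (-\<Delta>)\<^sup>t\<^sup>/\<^sup>2 f\<close>. An integrable function (like any periodic distribution) is determined,
  up to a null set, by its Fourier coefficients. For \<open>t > 0\<close> the multiplier vanishes at
  \<open>\<nu> = 0\<close>, because \<open>0 powr t = 0\<close>.
\<close>

definition is_frac_laplacian :: "real \<Rightarrow> (real \<Rightarrow> complex) \<Rightarrow> (real \<Rightarrow> complex) \<Rightarrow> bool" where
  "is_frac_laplacian t f g \<longleftrightarrow>
     (\<forall>\<nu>. fourier_coeff g \<nu> = of_real (\<bar>of_int \<nu>\<bar> powr t) * fourier_coeff f \<nu>)"

definition H_circle :: "real \<Rightarrow> real \<Rightarrow> (real \<Rightarrow> complex) set" where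
  "H_circle t p = {f \<in> Lp_circle p. \<exists>g \<in> Lp_circle p. is_frac_laplacian t f g}"

definition ennreal_powr :: "ennreal \<Rightarrow> real \<Rightarrow> ennreal" where
  "ennreal_powr x r = (if x = \<infinity> then \<infinity> else ennreal (enn2real x powr r))"

text \<open>
  The seminorm takes the value \<open>\<infinity>\<close> when the integral diverges. The integrand is \<open>0\<close> on the
  null set \<open>h = 0\<close> by the convention for division by zero.
\<close>

definition gagliardo_seminorm :: "real \<Rightarrow> real \<Rightarrow> (real \<Rightarrow> complex) \<Rightarrow> ennreal" where
  "gagliardo_seminorm s p f =
     ennreal_powr
       (\<integral>\<^sup>+h. (\<integral>\<^sup>+x. ennreal (norm (f (x + h) - f x) powr p / \<bar>h\<bar> powr (s * p + 1))
                 \<partial>circle_measure) \<partial>lebesgue)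
       (1 / p)"

end

theory Submission
  imports Defs
begin

text \<open>
  Put \<open>b = t - 1 / p\<close>. The coefficients \<open>\<nu> powr (- b - 1)\<close> are, up to the factor \<open>Gamma (b + 1)\<close>,
  the integrals of \<open>y powr b * exp (- \<nu> * y)\<close> over \<open>y > 0\<close>. Summation under the integral represents
  the function as a superposition of Poisson kernels \<open>P y\<close>,
  \<open>f x = C * \<integral> y powr b * (P y x - 1)\<close>, and all positive assertions follow from elementary bounds
  for \<open>P y\<close>. This kernel has mean 1 and maximum of order \<open>1 / y\<close>, hence \<open>L\<^sup>p\<close> norm of order
  \<open>y powr (1 / p - 1)\<close> for small \<open>y\<close>, and by Harnack's inequality the \<open>L\<^sup>p\<close> norm of its increments under
  a translation by \<open>h\<close> is smaller by the factor \<open>min 1 (\<bar>h\<bar> / y)\<close>.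

  Minkowski's integral inequality (\<open>minkowski_powr_integral\<close>) then shows \<open>f \<in> L\<^sup>p\<close>, and bounds the norm
  of \<open>f (x + h) - f x\<close> by a multiple of \<open>\<integral> y powr (t - 1) * min 1 (\<bar>h\<bar> / y)\<close>, which is a multiple of
  \<open>\<bar>h\<bar> powr t\<close> because \<open>0 < t < 1\<close> (\<open>riesz_kernel_increment_Lp\<close>). So \<open>f\<close> lies in a Besov space of order \<open>t\<close> with
  third index \<open>\<infinity>\<close>, and the integral of \<open>\<bar>h\<bar> powr ((t - s) * p - 1)\<close> near 0 makes the \<open>p\<close>-th power
  of the Gagliardo seminorm of order \<open>s\<close> blow up at most like \<open>1 / (t - s)\<close>
  (\<open>gagliardo_seminorm_le_of_Lp_modulus\<close>).

  Membership in \<open>H\<close> fails because \<open>(-\<Delta>)\<^sup>t\<^sup>/\<^sup>2 f\<close> would have the coefficients \<open>\<nu> powr (1 / p - 1)\<close>, those of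
  a function with the singularity \<open>\<bar>x\<bar> powr (- 1 / p)\<close>, which just fails to be in \<open>L\<^sup>p\<close>. The
  Poisson integral at 0 detects this: for such a series it grows at least like
  \<open>y powr (- 1 / p)\<close>, while that of an \<open>L\<^sup>p\<close> function is of smaller order
  (\<open>not_Lp_critical_cosine_series\<close>).

  Since the hypothesis on \<open>f\<close> concerns only its Fourier coefficients, the explicit function has to be
  identified with \<open>f\<close> almost everywhere; this is the uniqueness theorem for Fourier series
  (\<open>fourier_coeff_eq_0_imp_AE_eq_0\<close>), which again follows from the Poisson kernel.
\<close>

section \<open>The integral inequalities of Jensen and Minkowski\<close>

lemma powr_above_tangent:
  fixes m z p :: real
  assumes p: "1 < p" and z: "0 \<le> z" and m: "0 \<le> m"
  shows "m powr p + p * m powr (p - 1) * (z - m) \<le> z powr p"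
proof (cases "z = 0 \<or> m = 0")
  case True
  have "m * m powr (p - 1) = m powr p" using m p by (simp add: powr_mult_base)
  with True p show ?thesis
    by (auto simp: algebra_simps) (metis mult_le_cancel_right1 mult.commute powr_ge_zero less_imp_le not_less)
next
  case False
  with z m have "0 < z" "0 < m" by auto
  have "z powr p - m powr p \<ge> (p * m powr (p - 1)) * (z - m)"
    using \<open>0 < z\<close> \<open>0 < m\<close> p
    by (intro convex_on_imp_above_tangent[OF powr_convex])
       (auto intro!: derivative_eq_intros simp: interior_open)
  thus ?thesis by simp
qed

lemma le_one_plus_powr:
  fixes v p :: real
  assumes p: "1 < p" and v: "0 \<le> v"
  shows "v \<le> 1 + v powr p"
proof (cases "v \<le> 1")
  case False
  hence "v powr 1 \<le> v powr p" using p by (intro powr_mono) auto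
  thus ?thesis using False by simp
qed (use powr_ge_zero[of v p] in linarith)

text \<open>
  Jensen's inequality for \<open>z powr p\<close> and the finite measure \<open>w \<cdot> N\<close>: the tangent to \<open>z powr p\<close> at the
  mean value \<open>m\<close> of \<open>v\<close> lies below the curve, and its integral is \<open>W * m powr p\<close>.
\<close>

lemma jensen_powr_integral:
  fixes w v :: "'a \<Rightarrow> real"
  assumes p: "1 < p" and w: "integrable N w" "\<And>y. 0 \<le> w y"
    and v [measurable]: "v \<in> borel_measurable N" and v0: "\<And>y. 0 \<le> v y"
    and i: "integrable N (\<lambda>y. w y * v y powr p)"
  shows "integrable N (\<lambda>y. w y * v y)"
    and "(\<integral>y. w y * v y \<partial>N) powr p \<le> (\<integral>y. w y \<partial>N) powr (p - 1) * (\<integral>y. w y * v y powr p \<partial>N)"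
proof -
  have [measurable]: "w \<in> borel_measurable N" using w by simp
  have "w y * v y \<le> w y + w y * v y powr p" for y
    using mult_left_mono[OF le_one_plus_powr[OF p v0] w(2), of y y] by (simp add: distrib_left)
  thus int: "integrable N (\<lambda>y. w y * v y)"
    using w v0 by (intro Bochner_Integration.integrable_bound[OF Bochner_Integration.integrable_add[OF w(1) i]]) 
      (auto intro!: AE_I2 simp: abs_mult)
  define W where "W = (\<integral>y. w y \<partial>N)"
  define I where "I = (\<integral>y. w y * v y \<partial>N)"
  have W0: "W \<ge> 0" and I0: "I \<ge> 0" unfolding W_def I_def using w v0 by (auto intro!: integral_nonneg)
  show "I powr p \<le> W powr (p - 1) * (\<integral>y. w y * v y powr p \<partial>N)"
  proof (cases "W = 0")
    case True
    hence "AE y in N. w y = 0"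
      using w by (simp add: W_def integral_nonneg_eq_0_iff_AE)
    hence "I = 0" unfolding I_def by (intro integral_eq_zero_AE) auto
    thus ?thesis using p True by simp
  next
    case False
    with W0 have W: "W > 0" by simp
    define m where "m = I / W"
    have m: "m \<ge> 0" using I0 W by (simp add: m_def)
    have "W * m powr p = (\<integral>y. w y * m powr p + p * m powr (p - 1) * (w y * v y - w y * m) \<partial>N)"
      using w int W by (simp add: W_def[symmetric] I_def[symmetric]) (simp add: m_def)
    also have "\<dots> \<le> (\<integral>y. w y * v y powr p \<partial>N)"
    proof (rule integral_mono[OF _ i])
      show "w y * m powr p + p * m powr (p - 1) * (w y * v y - w y * m) \<le> w y * v y powr p" for y
        using mult_left_mono[OF powr_above_tangent[OF p v0 m] w(2), of y y] by (simp add: algebra_simps)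
    qed (use w int in auto)
    finally have "W powr (p - 1) * (W * m powr p) \<le> W powr (p - 1) * (\<integral>y. w y * v y powr p \<partial>N)"
      by (intro mult_left_mono) auto
    moreover have "W powr (p - 1) * (W * m powr p) = I powr p"
    proof -
      have "W powr (p - 1) * W = W powr p" using W by (simp add: powr_mult_base mult.commute)
      hence "W powr (p - 1) * (W * m powr p) = W powr p * m powr p" by (simp flip: mult.assoc)
      also have "\<dots> = I powr p" using W m by (simp add: powr_mult[symmetric] m_def)
      finally show ?thesis .
    qed
    ultimately show ?thesis by simp
  qed
qed

text \<open>
  Minkowski's integral inequality in the form used below: a superposition of functions \<open>V \<cdot> y\<close> whose
  \<open>L\<^sup>p\<close> norms have a common bound inherits this bound, times the total weight. Jensen's inequality in
  the variable \<open>y\<close>, followed by Tonelli's theorem, gives it.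
\<close>

lemma minkowski_powr_integral:
  fixes V :: "'a \<Rightarrow> 'b \<Rightarrow> real" and w :: "'b \<Rightarrow> real"
  assumes fin: "finite_measure M" and sf: "sigma_finite_measure N"
    and p: "1 < p" and w: "integrable N w" "\<And>y. 0 \<le> w y" and K: "0 \<le> K"
    and V [measurable]: "(\<lambda>(x, y). V x y) \<in> borel_measurable (M \<Otimes>\<^sub>M N)"
    and bound: "\<And>y. w y \<noteq> 0 \<Longrightarrow> (\<integral>\<^sup>+x. ennreal (\<bar>V x y\<bar> powr p) \<partial>M) \<le> ennreal K"
  shows "integrable (M \<Otimes>\<^sub>M N) (\<lambda>(x, y). w y * V x y)"
    and "AE x in M. integrable N (\<lambda>y. w y * V x y)"
    and "(\<integral>\<^sup>+x. ennreal (\<bar>\<integral>y. w y * V x y \<partial>N\<bar> powr p) \<partial>M) \<le> ennreal (K * (\<integral>y. w y \<partial>N) powr p)"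
proof -
  interpret M: finite_measure M by fact
  interpret N: sigma_finite_measure N by fact
  interpret pair_sigma_finite M N ..
  have [measurable]: "w \<in> borel_measurable N" using w by simp
  define W where "W = (\<integral>y. w y \<partial>N)"
  have W0: "W \<ge> 0" unfolding W_def using w by (auto intro!: integral_nonneg)
  define Q where "Q = (\<lambda>(x, y). w y * \<bar>V x y\<bar> powr p)"
  have Q0: "Q z \<ge> 0" for z using w by (auto simp: Q_def split_beta)
  have Qm [measurable]: "Q \<in> borel_measurable (M \<Otimes>\<^sub>M N)" unfolding Q_def by measurable
  have Qle: "(\<integral>\<^sup>+z. ennreal (Q z) \<partial>(M \<Otimes>\<^sub>M N)) \<le> ennreal (K * W)"
  proof -
    have "(\<integral>\<^sup>+z. ennreal (Q z) \<partial>(M \<Otimes>\<^sub>M N)) = (\<integral>\<^sup>+y. (\<integral>\<^sup>+x. ennreal (Q (x, y)) \<partial>M) \<partial>N)"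
      by (subst nn_integral_snd[symmetric]) auto
    also have "\<dots> \<le> (\<integral>\<^sup>+y. ennreal (K * w y) \<partial>N)"
    proof (rule nn_integral_mono)
      fix y assume y: "y \<in> space N"
      have "(\<integral>\<^sup>+x. ennreal (Q (x, y)) \<partial>M) = ennreal (w y) * (\<integral>\<^sup>+x. ennreal (\<bar>V x y\<bar> powr p) \<partial>M)"
        using w y by (simp add: Q_def ennreal_mult nn_integral_cmult)
      also have "\<dots> \<le> ennreal (w y) * ennreal K"
        using bound[of y] by (cases "w y = 0") (auto intro: mult_left_mono)
      finally show "(\<integral>\<^sup>+x. ennreal (Q (x, y)) \<partial>M) \<le> ennreal (K * w y)"
        using w K by (simp add: ennreal_mult mult.commute)
    qed
    also have "\<dots> = ennreal (K * W)"
      using w K by (subst nn_integral_eq_integral) (auto simp: W_def)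
    finally show ?thesis .
  qed
  have Qi: "integrable (M \<Otimes>\<^sub>M N) Q"
    using Qle Q0 by (intro integrableI_bounded) (auto simp: le_less_trans)
  have wi: "integrable (M \<Otimes>\<^sub>M N) (\<lambda>z. w (snd z))"
    by (rule Fubini_integrable) (use w in auto)
  show int: "integrable (M \<Otimes>\<^sub>M N) (\<lambda>(x, y). w y * V x y)"
  proof (rule Bochner_Integration.integrable_bound[OF Bochner_Integration.integrable_add[OF wi Qi]])
    show "AE z in M \<Otimes>\<^sub>M N. norm (case z of (x, y) \<Rightarrow> w y * V x y) \<le> norm (w (snd z) + Q z)"
    proof (intro AE_I2, clarify)
      fix x y
      have "w y * \<bar>V x y\<bar> \<le> w y * (1 + \<bar>V x y\<bar> powr p)"
        using le_one_plus_powr[OF p, of "\<bar>V x y\<bar>"] w by (intro mult_left_mono) auto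
      thus "norm (w y * V x y) \<le> norm (w (snd (x, y)) + Q (x, y))"
        using w by (simp add: Q_def abs_mult distrib_left)
    qed
  qed measurable
  show AEi: "AE x in M. integrable N (\<lambda>y. w y * V x y)"
    using AE_integrable_fst'[OF int] by simp
  have AEQ: "AE x in M. integrable N (\<lambda>y. w y * \<bar>V x y\<bar> powr p)"
    using AE_integrable_fst'[OF Qi] by (simp add: Q_def)
  have "(\<integral>\<^sup>+x. ennreal (\<bar>\<integral>y. w y * V x y \<partial>N\<bar> powr p) \<partial>M)
      \<le> (\<integral>\<^sup>+x. ennreal (W powr (p - 1)) * (\<integral>\<^sup>+y. ennreal (Q (x, y)) \<partial>N) \<partial>M)"
  proof (rule nn_integral_mono_AE)
    show "AE x in M. ennreal (\<bar>\<integral>y. w y * V x y \<partial>N\<bar> powr p) \<le> ennreal (W powr (p - 1)) * (\<integral>\<^sup>+y. ennreal (Q (x, y)) \<partial>N)"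
      using AEQ AE_space
    proof eventually_elim
      case (elim x)
      have [measurable]: "(\<lambda>y. \<bar>V x y\<bar>) \<in> borel_measurable N" using elim by measurable
      have "\<bar>\<integral>y. w y * V x y \<partial>N\<bar> \<le> (\<integral>y. w y * \<bar>V x y\<bar> \<partial>N)"
        using integral_abs_bound[of N "\<lambda>y. w y * V x y"] w by (simp add: abs_mult)
      hence "\<bar>\<integral>y. w y * V x y \<partial>N\<bar> powr p \<le> (\<integral>y. w y * \<bar>V x y\<bar> \<partial>N) powr p"
        using p by (intro powr_mono2) auto
      also have "\<dots> \<le> W powr (p - 1) * (\<integral>y. w y * \<bar>V x y\<bar> powr p \<partial>N)"
        unfolding W_def by (rule jensen_powr_integral(2)[OF p w _ _ elim(1)]) auto
      finally have "ennreal (\<bar>\<integral>y. w y * V x y \<partial>N\<bar> powr p) \<le> ennreal (W powr (p - 1) * (\<integral>y. w y * \<bar>V x y\<bar> powr p \<partial>N))"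
        by (rule ennreal_leI)
      also have "\<dots> = ennreal (W powr (p - 1)) * ennreal (\<integral>y. w y * \<bar>V x y\<bar> powr p \<partial>N)"
        by (rule ennreal_mult') simp
      also have "ennreal (\<integral>y. w y * \<bar>V x y\<bar> powr p \<partial>N) = (\<integral>\<^sup>+y. ennreal (Q (x, y)) \<partial>N)"
        using elim w by (subst nn_integral_eq_integral) (auto simp: Q_def)
      finally show ?case .
    qed
  qed
  also have "\<dots> = ennreal (W powr (p - 1)) * (\<integral>\<^sup>+z. ennreal (Q z) \<partial>(M \<Otimes>\<^sub>M N))"
    by (subst N.nn_integral_fst[symmetric]) (auto simp: nn_integral_cmult)
  also have "\<dots> \<le> ennreal (W powr (p - 1)) * ennreal (K * W)"
    using Qle by (intro mult_left_mono) auto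
  also have "\<dots> = ennreal (K * W powr p)"
    using W0 K by (subst ennreal_mult'[symmetric]) (auto simp: powr_mult_base mult_ac)
  finally show "(\<integral>\<^sup>+x. ennreal (\<bar>\<integral>y. w y * V x y \<partial>N\<bar> powr p) \<partial>M) \<le> ennreal (K * (\<integral>y. w y \<partial>N) powr p)"
    by (simp add: W_def)
qed

section \<open>Pointwise bounds for the Poisson kernel\<close>

text \<open>
  This is the Poisson kernel of the unit disc at radius \<open>exp (- y)\<close>, that is
  \<open>1 + 2 * (\<Sum>n\<ge>1. exp (- n * y) * cos (n * x))\<close>. The variable \<open>y\<close> is used because
  \<open>exp (- n * y)\<close> is what the Gamma integral turns into a power of \<open>n\<close>.
\<close>

definition poisson :: "real \<Rightarrow> real \<Rightarrow> real" where
  "poisson y x = sinh y / (cosh y - cos x)"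

lemma cosh_minus_cos_pos: "y > 0 \<Longrightarrow> 0 < cosh y - cos (x::real)"
  by (smt (verit) cos_le_one cosh_real_ge_1 cosh_real_one_iff)

lemma poisson_pos: "y > 0 \<Longrightarrow> 0 < poisson y x"
  by (metis poisson_def cosh_minus_cos_pos divide_pos_pos sinh_real_pos_iff)

text \<open>
  The sum starts at \<open>n = 0\<close> with the term 2, hence the additional 1 on the right: it is the real part
  of a geometric series.
\<close>

lemma poisson_sums:
  assumes y: "y > 0"
  shows "(\<lambda>n. 2 * exp (- y) ^ n * cos (real n * x)) sums (poisson y x + 1)"
proof -
  define r where "r = exp (- y)"
  have r: "0 < r" "r < 1" using y by (auto simp: r_def)
  define z where "z = of_real r * cis x"
  have nz: "norm z < 1" using r by (simp add: z_def norm_mult)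
  have re: "Re (z ^ n) = r ^ n * cos (real n * x)" for n
    by (simp add: z_def power_mult_distrib Complex.DeMoivre flip: of_real_power)
  have "(\<lambda>n. Re (z ^ n)) sums Re (1 / (1 - z))"
    by (intro sums_Re geometric_sums nz)
  hence s: "(\<lambda>n. 2 * (r ^ n * cos (real n * x))) sums (2 * Re (1 / (1 - z)))"
    unfolding re by (intro sums_mult)
  have d: "(1 - r * cos x)\<^sup>2 + (r * sin x)\<^sup>2 = 2 * r * (cosh y - cos x)"
  proof -
    have "2 * r * cosh y = 1 + r\<^sup>2"
      by (simp add: r_def cosh_field_def field_simps power2_eq_square flip: exp_add)
    moreover have "(1 - r * cos x)\<^sup>2 + (r * sin x)\<^sup>2 = 1 - 2 * r * cos x + r\<^sup>2 * ((cos x)\<^sup>2 + (sin x)\<^sup>2)"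
      by algebra
    ultimately show ?thesis by (simp add: algebra_simps)
  qed
  have e: "2 * r * (sinh y + cosh y) = 2"
    by (simp add: sinh_plus_cosh r_def flip: exp_add)
  have "2 * Re (1 / (1 - z)) = 2 * (1 - r * cos x) / (2 * r * (cosh y - cos x))"
    using d by (simp add: Re_divide z_def)
  also have "\<dots> = (2 * r * (sinh y + cosh y) - 2 * r * cos x) / (2 * r * (cosh y - cos x))"
    by (simp add: e)
  also have "\<dots> = poisson y x + 1"
    using r cosh_minus_cos_pos[OF y, of x]
    by (simp add: poisson_def divide_simps) (simp add: algebra_simps)
  finally show ?thesis using s by (simp add: r_def mult.assoc)
qed

text \<open>
  The extreme values of the kernel are \<open>coth (y / 2)\<close> and \<open>tanh (y / 2)\<close>, at distance at most
  \<open>2 / (exp y - 1)\<close> from 1. The first bound is of the right order for small \<open>y\<close>; the second one gives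
  the decay that makes the integrals over \<open>y\<close> converge at infinity.
\<close>

lemma poisson_shift_bound:
  assumes y: "y > 0"
  shows "\<bar>poisson y x - 1\<bar> \<le> 2 / y" "\<bar>poisson y x - 1\<bar> \<le> 4 / y\<^sup>2"
proof -
  have e1: "cosh y - sinh y \<le> 1" using y by (simp add: cosh_minus_sinh)
  have ge: "exp y \<ge> 1 + y + y\<^sup>2 / 2" using y by (intro exp_lower_Taylor_quadratic) auto
  have c1: "cosh y \<ge> 1" by (rule cosh_real_ge_1)
  have em: "1 < exp y" using y by simp
  have up: "poisson y x - 1 \<le> 2 / (exp y - 1)"
  proof -
    have "poisson y x \<le> sinh y / (cosh y - 1)"
      unfolding poisson_def using y cosh_minus_cos_pos[OF y, of x] cosh_minus_cos_pos[OF y, of 0]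
      by (intro divide_left_mono) auto
    also have "\<dots> = 1 + 2 / (exp y - 1)"
    proof -
      have "sinh y * (exp y - 1) = (cosh y - 1) * (exp y + 1)"
        by (simp add: sinh_field_def cosh_field_def field_simps flip: exp_add)
      thus ?thesis using em cosh_minus_cos_pos[OF y, of 0]
        by (simp add: field_simps)
    qed
    finally show ?thesis by simp
  qed
  have lo: "1 - poisson y x \<le> 2 / (exp y - 1)"
  proof -
    have "sinh y / (cosh y + 1) \<le> poisson y x"
      unfolding poisson_def using y cosh_minus_cos_pos[OF y, of x] cos_ge_minus_one[of x]
      by (intro divide_left_mono mult_pos_pos) (simp_all add: add_pos_pos)
    moreover have "sinh y / (cosh y + 1) = 1 - 2 / (exp y + 1)"
    proof -
      have "sinh y * (exp y + 1) = (cosh y + 1) * (exp y - 1)"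
        by (simp add: sinh_field_def cosh_field_def field_simps flip: exp_add)
      moreover have "cosh y + 1 \<noteq> 0" "exp y + 1 \<noteq> 0" using em c1 by linarith+
      ultimately show ?thesis
        by (simp add: divide_simps)
    qed
    moreover have "2 / (exp y + 1) \<le> 2 / (exp y - 1)" using em
      by (intro divide_left_mono mult_pos_pos) (simp_all add: add_pos_pos)
    ultimately show ?thesis by linarith
  qed
  have m: "\<bar>poisson y x - 1\<bar> \<le> 2 / (exp y - 1)" using up lo by linarith
  have "y \<le> exp y - 1" using exp_ge_add_one_self[of y] by linarith
  hence "2 / (exp y - 1) \<le> 2 / y"
    using y em by (intro divide_left_mono mult_pos_pos) simp_all
  with m show "\<bar>poisson y x - 1\<bar> \<le> 2 / y" by linarith
  have "y\<^sup>2 / 2 \<le> exp y - 1" using ge y by linarith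
  hence "2 / (exp y - 1) \<le> 2 / (y\<^sup>2 / 2)"
    using y em by (intro divide_left_mono mult_pos_pos) simp_all
  with m show "\<bar>poisson y x - 1\<bar> \<le> 4 / y\<^sup>2" by simp
qed

lemma poisson_le: "y > 0 \<Longrightarrow> poisson y x \<le> 1 + 2 / y"
  using poisson_shift_bound(1)[of y x] by linarith

lemma sinh_ge: 
  assumes "(y::real) \<ge> 0" shows "y \<le> sinh y" "y\<^sup>2 / 4 \<le> sinh y"
proof -
  show "y \<le> sinh y" using real_le_x_sinh[OF assms] by (simp add: sinh_field_def exp_minus)
  have "(1 + y + y\<^sup>2 / 2) - 1 \<le> exp y - exp (- y)"
    using assms by (intro diff_mono exp_lower_Taylor_quadratic) auto
  hence "(y + y\<^sup>2 / 2) / 2 \<le> sinh y" by (simp add: sinh_field_def)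
  moreover have "y\<^sup>2 / 4 \<le> (y + y\<^sup>2 / 2) / 2" using assms by simp
  ultimately show "y\<^sup>2 / 4 \<le> sinh y" by (rule order_trans[rotated])
qed

text \<open>
  The logarithmic derivative of the kernel in \<open>x\<close> is \<open>- sin x / (cosh y - cos x)\<close>; this bounds it by
  \<open>1 / sinh y\<close>. The difference of the squares of the two sides is a perfect square.
\<close>

lemma abs_sin_sinh_le:
  fixes x y :: real
  assumes y: "y > 0"
  shows "\<bar>sin x\<bar> * sinh y \<le> cosh y - cos x"
proof (rule power2_le_imp_le[where y = "cosh y - cos x"])
  have s: "(sin x)\<^sup>2 = 1 - (cos x)\<^sup>2" by (simp add: sin_squared_eq)
  have "(cosh y - cos x)\<^sup>2 - (\<bar>sin x\<bar> * sinh y)\<^sup>2 = (cosh y * cos x - 1)\<^sup>2"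
    unfolding power_mult_distrib power2_abs s sinh_square_eq
    by (simp add: algebra_simps power2_eq_square)
  thus "(\<bar>sin x\<bar> * sinh y)\<^sup>2 \<le> (cosh y - cos x)\<^sup>2"
    by (smt (verit) zero_le_power2)
qed (use cosh_minus_cos_pos[OF y, of x] in simp)

text \<open>
  Harnack's inequality, by integrating the bound for the logarithmic derivative.
\<close>

lemma poisson_harnack:
  assumes y: "y > 0"
  shows "poisson y a \<le> exp (\<bar>a - b\<bar> / sinh y) * poisson y b"
proof -
  define L where "L = (\<lambda>x. ln (cosh y - cos x))"
  have sy: "sinh y > 0" using y by simp
  have "norm (L b - L a) \<le> (1 / sinh y) * norm (b - a)"
  proof (rule field_differentiable_bound[where S = UNIV and f' = "\<lambda>x. sin x / (cosh y - cos x)"])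
    fix x :: real
    show "(L has_field_derivative sin x / (cosh y - cos x)) (at x within UNIV)"
      unfolding L_def using cosh_minus_cos_pos[OF y, of x]
      by (auto intro!: derivative_eq_intros simp: divide_simps)
    show "norm (sin x / (cosh y - cos x)) \<le> 1 / sinh y"
      using abs_sin_sinh_le[OF y, of x] cosh_minus_cos_pos[OF y, of x] sy
      by (simp add: field_simps)
  qed auto
  hence l: "L b - L a \<le> \<bar>a - b\<bar> / sinh y"
    by (simp add: abs_minus_commute) 
  have P: "poisson y x = sinh y * exp (- L x)" for x
    using cosh_minus_cos_pos[OF y, of x] by (simp add: poisson_def L_def exp_minus field_simps)
  have "poisson y a = exp (L b - L a) * poisson y b"
    unfolding P by (simp add: flip: exp_add)
  also have "\<dots> \<le> exp (\<bar>a - b\<bar> / sinh y) * poisson y b"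
    using l poisson_pos[OF y, of b] by (intro mult_right_mono) auto
  finally show ?thesis .
qed

text \<open>
  At scales \<open>\<bar>h\<bar> \<le> y\<close> a translation by \<open>h\<close> changes the kernel only by the relative amount
  \<open>\<bar>h\<bar> / y\<close>. This gain is what turns into smoothness of order \<open>t\<close> after integration over \<open>y\<close>.
\<close>

lemma poisson_increment:
  assumes y: "y > 0" and h: "\<bar>h\<bar> \<le> y"
  shows "\<bar>poisson y (x + h) - poisson y x\<bar> \<le> 4 * \<bar>h\<bar> / sinh y * poisson y x"
proof -
  define u where "u = \<bar>h\<bar> / sinh y"
  have sy: "sinh y > 0" using y by simp
  have u: "0 \<le> u" "u \<le> 1" using sinh_ge(1)[of y] y h sy by (auto simp: u_def)
  have e: "exp u \<le> 1 + 2 * u"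
    using exp_bound[of u] u mult_right_mono[of u 1 u] by (simp add: power2_eq_square)
  have P: "poisson y x > 0" by (rule poisson_pos[OF y])
  have 1: "poisson y (x + h) \<le> exp u * poisson y x"
    using poisson_harnack[OF y, of "x + h" x] by (simp add: u_def)
  hence 1: "poisson y (x + h) \<le> (1 + 2 * u) * poisson y x" 
    using e P by (meson mult_right_mono less_imp_le order_trans)
  have "poisson y x \<le> exp u * poisson y (x + h)"
    using poisson_harnack[OF y, of x "x + h"] by (simp add: u_def)
  hence "exp (-u) * poisson y x \<le> exp (-u) * (exp u * poisson y (x + h))" by (intro mult_left_mono) auto
  also have "\<dots> = poisson y (x + h)" by (simp flip: mult.assoc exp_add)
  finally have "exp (-u) * poisson y x \<le> poisson y (x + h)" .
  moreover have "(1 - u) * poisson y x \<le> exp (-u) * poisson y x"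
    using P exp_ge_add_one_self[of "-u"] by (intro mult_right_mono) auto
  ultimately have 2: "(1 - u) * poisson y x \<le> poisson y (x + h)" by linarith
  have "\<bar>poisson y (x + h) - poisson y x\<bar> \<le> 4 * u * poisson y x"
    using 1 2 P u mult_nonneg_nonneg[of u "poisson y x"] by (simp add: algebra_simps)
  thus ?thesis by (simp add: u_def)
qed

section \<open>Poisson integrals and Fourier coefficients\<close>

lemma finite_measure_circle: "finite_measure circle_measure"
  by (rule finite_measure_lebesgue_on) simp

lemma measurable_ident_circle [measurable]: "(\<lambda>x. x) \<in> borel_measurable circle_measure"
  by (simp add: measurable_restrict_space1 measurable_completion)

lemma measurable_cis [measurable]: "cis \<in> borel_measurable borel"
  by (intro borel_measurable_continuous_onI continuous_intros)

lemma measure_circle: "measure circle_measure (space circle_measure) = 2 * pi"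
  by (simp add: measure_restrict_space)

lemma AE_circle_neq: "AE x in circle_measure. x \<noteq> (a::real)"
proof -
  have "AE x in lebesgue. x \<in> {0..2*pi} \<longrightarrow> x \<noteq> a"
    by (intro AE_completion eventually_mono[OF AE_lborel_singleton[of a]]) simp
  thus ?thesis by (subst AE_restrict_space_iff) auto
qed

lemma measurable_poisson [measurable (raw)]:
  assumes [measurable]: "f \<in> borel_measurable M" "g \<in> borel_measurable M"
  shows "(\<lambda>z. poisson (f z) (g z)) \<in> borel_measurable M"
  unfolding poisson_def sinh_field_def cosh_field_def by measurable

lemma integrable_bounded_mult:
  fixes g :: "real \<Rightarrow> complex"
  assumes g: "integrable circle_measure g" and k[measurable]: "k \<in> borel_measurable circle_measure"
    and b: "\<And>x. norm (k x) \<le> B"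
  shows "integrable circle_measure (\<lambda>x. g x * k x)"
proof (rule Bochner_Integration.integrable_bound[OF integrable_mult_right[OF integrable_norm[OF g], of B]])
  have [measurable]: "g \<in> borel_measurable circle_measure" using g by simp
  show "(\<lambda>x. g x * k x) \<in> borel_measurable circle_measure" by measurable
  have "norm (g x) * norm (k x) \<le> B * norm (g x)" for x
    using mult_left_mono[OF b, of "norm (g x)" x] by (simp add: mult.commute)
  moreover have "B \<ge> 0" using b[of 0] norm_ge_zero order_trans by blast
  ultimately show "AE x in circle_measure. norm (g x * k x) \<le> norm (B * norm (g x))"
    by (auto simp: norm_mult)
qed

lemma integral_cis_eq_fourier_coeff:
  "(\<integral>x. g x * cis (of_int k * x) \<partial>circle_measure) = 2 * pi * fourier_coeff g (- k)"
  by (simp add: fourier_coeff_def)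

text \<open>
  The Poisson integral of an integrable function is determined by its Fourier coefficients, since
  the cosine series of the kernel converges uniformly for fixed \<open>y > 0\<close>. The summand at \<open>n = 0\<close>
  contains the mean value of \<open>g\<close> twice, and the second copy is the additional term on the right.
\<close>

lemma poisson_integral_sums:
  fixes g :: "real \<Rightarrow> complex"
  assumes y: "y > 0" and g: "integrable circle_measure g"
  shows "(\<lambda>n. 2 * pi * exp (- y) ^ n * (fourier_coeff g (int n) * cis (real n * z) + fourier_coeff g (- int n) * cis (- (real n * z))))
     sums ((\<integral>x. g x * poisson y (x - z) \<partial>circle_measure) + 2 * pi * fourier_coeff g 0)"
proof -
  define q where "q n x = 2 * exp (- y) ^ n * cos (real n * (x - z))" for n :: nat and x
  define F where "F n x = g x * complex_of_real (q n x)" for n :: nat and x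
  have [measurable]: "g \<in> borel_measurable circle_measure" using g by simp
  have [measurable]: "q n \<in> borel_measurable circle_measure" for n unfolding q_def by measurable
  have b: "\<bar>q n x\<bar> \<le> 2 * exp (- y) ^ n" for n x
    by (simp add: q_def abs_mult)
  have nF: "norm (F n x) \<le> 2 * exp (- y) ^ n * norm (g x)" for n x
    using mult_right_mono[OF b, of "norm (g x)"] by (simp add: F_def norm_mult mult.commute)
  have smr: "summable (\<lambda>n. exp (- y) ^ n * c)" for c using y by (intro summable_mult2 summable_geometric) simp
  have int: "integrable circle_measure (F n)" for n
    unfolding F_def[abs_def] using b[of n] by (intro integrable_bounded_mult[OF g]) auto
  have s: "(\<lambda>n. F n x) sums (g x * (poisson y (x - z) + 1))" for x
  proof -
    have "(\<lambda>n. complex_of_real (q n x)) sums (complex_of_real (poisson y (x - z) + 1))"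
      unfolding q_def sums_of_real_iff by (rule poisson_sums[OF y])
    from sums_mult[OF this, of "g x"] show ?thesis by (simp add: F_def)
  qed
  have "(\<lambda>n. integral\<^sup>L circle_measure (F n)) sums (\<integral>x. (\<Sum>n. F n x) \<partial>circle_measure)"
  proof (rule sums_integral[OF int])
    show "AE x in circle_measure. summable (\<lambda>i. norm (F i x))"
    proof (intro AE_I2 summable_comparison_test[OF _ smr] exI allI impI)
      show "norm (norm (F n x)) \<le> exp (- y) ^ n * (2 * norm (g x))" for n x
        using nF[of n x] by (simp add: mult_ac)
    qed
    show "summable (\<lambda>i. \<integral>x. norm (F i x) \<partial>circle_measure)"
    proof (rule summable_comparison_test[OF _ smr], intro exI allI impI)
      fix n
      have "(\<integral>x. norm (F n x) \<partial>circle_measure) \<le> (\<integral>x. 2 * exp (- y) ^ n * norm (g x) \<partial>circle_measure)"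
        using nF by (intro integral_mono integrable_norm int integrable_mult_right g) auto
      also have "\<dots> = exp (- y) ^ n * (2 * (\<integral>x. norm (g x) \<partial>circle_measure))" by simp
      finally show "norm (\<integral>x. norm (F n x) \<partial>circle_measure) \<le> exp (- y) ^ n * (2 * (\<integral>x. norm (g x) \<partial>circle_measure))"
        by simp
    qed
  qed
  also have "(\<lambda>x. \<Sum>n. F n x) = (\<lambda>x. g x * poisson y (x - z) + g x)"
    using sums_unique[OF s] by (simp add: fun_eq_iff distrib_left)
  also have "(\<integral>x. g x * poisson y (x - z) + g x \<partial>circle_measure)
    = (\<integral>x. g x * poisson y (x - z) \<partial>circle_measure) + (\<integral>x. g x \<partial>circle_measure)"
  proof (rule Bochner_Integration.integral_add[OF _ g])
    have "norm (poisson y (x - z)) \<le> 1 + 2 / y" for x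
      using poisson_pos[OF y, of "x - z"] poisson_le[OF y, of "x - z"] by simp
    thus "integrable circle_measure (\<lambda>x. g x * poisson y (x - z))"
      by (intro integrable_bounded_mult[OF g]) auto
  qed
  also have "(\<integral>x. g x \<partial>circle_measure) = 2 * pi * fourier_coeff g 0"
    by (simp add: fourier_coeff_def)
  finally have S: "(\<lambda>n. integral\<^sup>L circle_measure (F n)) sums
    ((\<integral>x. g x * poisson y (x - z) \<partial>circle_measure) + 2 * pi * fourier_coeff g 0)" .
  have "integral\<^sup>L circle_measure (F n) = 2 * pi * exp (- y) ^ n * (fourier_coeff g (int n) * cis (real n * z) + fourier_coeff g (- int n) * cis (- (real n * z)))" for n
  proof -
    have I: "integrable circle_measure (\<lambda>x. g x * cis (c * x))" for c
      by (intro integrable_bounded_mult[OF g, where B=1]) auto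
    have "F n x = exp (- y) ^ n * (cis (real n * z) * (g x * cis (of_int (- int n) * x)) + cis (- (real n * z)) * (g x * cis (of_int (int n) * x)))" for x
    proof -
      have "2 * complex_of_real (cos a) = cis (- a) + cis a" for a
        by (simp add: complex_eq_iff)
      note this[of "real n * (x - z)"]
      moreover have "cis (- (real n * (x - z))) = cis (real n * z) * cis (of_int (- int n) * x)"
        "cis (real n * (x - z)) = cis (- (real n * z)) * cis (of_int (int n) * x)"
        by (simp_all add: cis_mult algebra_simps)
      ultimately have "2 * complex_of_real (cos (real n * (x - z)))
        = cis (real n * z) * cis (of_int (- int n) * x) + cis (- (real n * z)) * cis (of_int (int n) * x)"
        by simp
      moreover have "F n x = exp (- y) ^ n * (g x * (2 * complex_of_real (cos (real n * (x - z)))))"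
        by (simp add: F_def q_def)
      ultimately show ?thesis
        by (simp only: distrib_left mult_ac)
    qed
    hence "F n = (\<lambda>x. exp (- y) ^ n * (cis (real n * z) * (g x * cis (of_int (- int n) * x)) + cis (- (real n * z)) * (g x * cis (of_int (int n) * x))))"
      by (rule ext)
    hence "integral\<^sup>L circle_measure (F n) = exp (- y) ^ n * (cis (real n * z) * (\<integral>x. g x * cis (of_int (- int n) * x) \<partial>circle_measure) + cis (- (real n * z)) * (\<integral>x. g x * cis (of_int (int n) * x) \<partial>circle_measure))"
      using I[of "of_int (int n)"] I[of "of_int (- int n)"] by simp
    also have "\<dots> = 2 * pi * exp (- y) ^ n * (fourier_coeff g (int n) * cis (real n * z) + fourier_coeff g (- int n) * cis (- (real n * z)))"
      unfolding integral_cis_eq_fourier_coeff by (simp add: algebra_simps)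
    finally show ?thesis .
  qed
  with S show ?thesis by (simp only:)
qed

lemma fourier_coeff_cis: "fourier_coeff (\<lambda>x. cis (of_int m * x)) k = (if k = m then 1 else 0)"
proof (cases "k = m")
  case True
  thus ?thesis using measure_circle by (simp add: fourier_coeff_def cis_mult scaleR_conv_of_real)
next
  case False
  define d where "d = real_of_int (m - k)"
  have d: "d \<noteq> 0" using False by (simp add: d_def)
  define G where "G x = cis (d * x) / (\<i> * d)" for x
  have "((\<lambda>x. cis (d * x)) has_integral (G (2*pi) - G 0)) {0..2*pi}"
  proof (rule fundamental_theorem_of_calculus)
    fix x
    have "((\<lambda>x. cis (d * x)) has_vector_derivative d *\<^sub>R (\<i> * cis (d * x))) (at x within {0..2*pi})"
      unfolding cis_conv_exp
      by (auto intro!: derivative_eq_intros has_vector_derivative_real_field simp: scaleR_conv_of_real)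
    from has_vector_derivative_mult_right[OF this, of "1 / (\<i> * d)"] d
    show "(G has_vector_derivative cis (d * x)) (at x within {0..2*pi})"
      by (simp add: G_def[abs_def] scaleR_conv_of_real field_simps)
  qed simp
  moreover have "G (2*pi) = G 0"
    using cis_multiple_2pi[of d] by (simp add: G_def d_def mult.commute)
  ultimately have "integral {0..2*pi} (\<lambda>x. cis (d * x)) = 0" by (simp add: integral_unique)
  moreover have "integrable circle_measure (\<lambda>x. cis (d * x))"
    using finite_measure_circle by (intro finite_measure.integrable_const_bound[where B = 1]) auto
  ultimately have "(\<integral>x. cis (d * x) \<partial>circle_measure) = 0"
    by (subst lebesgue_integral_eq_integral) auto
  thus ?thesis using False by (simp add: fourier_coeff_def cis_mult d_def algebra_simps)
qed

text \<open>
  Characters are eigenfunctions of the Poisson integral.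
\<close>

lemma integral_cis_poisson:
  assumes y: "y > 0"
  shows "(\<integral>x. cis (of_int m * x) * poisson y (x - z) \<partial>circle_measure) = 2 * pi * exp (- y * \<bar>of_int m\<bar>) * cis (of_int m * z)"
proof -
  have I: "integrable circle_measure (\<lambda>x. cis (of_int m * x))"
    using finite_measure_circle by (intro finite_measure.integrable_const_bound[where B = 1]) auto
  let ?f = "\<lambda>n::nat. 2 * pi * exp (- y) ^ n * ((if int n = m then 1 else 0) * cis (real n * z) + (if - int n = m then 1 else 0) * cis (- (real n * z)))"
  note s = poisson_integral_sums[OF y I, of z, unfolded fourier_coeff_cis]
  have "?f sums (\<Sum>n\<in>{nat \<bar>m\<bar>}. ?f n)"
    by (rule sums_finite) auto
  from sums_unique2[OF s this]
  show ?thesis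
    by (cases "m = 0"; cases "m > 0") (auto simp: exp_of_nat_mult[symmetric] mult.commute)
qed

lemma integral_poisson:
  assumes y: "y > 0" shows "integrable circle_measure (\<lambda>x. poisson y (x + h))"
    "(\<integral>x. poisson y (x + h) \<partial>circle_measure) = 2 * pi"
    "(\<integral>\<^sup>+x. ennreal (poisson y (x + h)) \<partial>circle_measure) = ennreal (2 * pi)"
proof -
  have "norm (poisson y (x + h)) \<le> 1 + 2 / y" for x
    using poisson_pos[OF y, of "x + h"] poisson_le[OF y, of "x + h"] by simp
  thus I: "integrable circle_measure (\<lambda>x. poisson y (x + h))"
    by (intro finite_measure.integrable_const_bound[OF finite_measure_circle, where B="1 + 2/y"]) auto
  have "complex_of_real (\<integral>x. poisson y (x + h) \<partial>circle_measure) = complex_of_real (2 * pi)"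
    using integral_cis_poisson[OF y, of 0 "-h"] by simp
  thus e: "(\<integral>x. poisson y (x + h) \<partial>circle_measure) = 2 * pi" using of_real_eq_iff by blast
  show "(\<integral>\<^sup>+x. ennreal (poisson y (x + h)) \<partial>circle_measure) = ennreal (2 * pi)"
    using poisson_pos[OF y] by (subst nn_integral_eq_integral[OF I]) (auto simp: e less_imp_le)
qed

section \<open>Uniqueness of Fourier series\<close>

lemma integrable_pair_fst:
  fixes g :: "'a \<Rightarrow> real"
  assumes M: "sigma_finite_measure M" and N: "finite_measure N" and g: "integrable M g"
  shows "integrable (M \<Otimes>\<^sub>M N) (\<lambda>z. g (fst z))"
proof -
  interpret M: sigma_finite_measure M by fact
  interpret N: finite_measure N by fact
  interpret pair_sigma_finite M N ..
  have [measurable]: "g \<in> borel_measurable M" using g by simp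
  show ?thesis
  proof (rule Fubini_integrable)
    show "integrable M (\<lambda>x. \<integral>y. norm (g (fst (x, y))) \<partial>N)" using g by simp
    show "AE x in M. integrable N (\<lambda>y. g (fst (x, y)))" by simp
  qed measurable
qed


lemma poisson_le_off_diagonal:
  assumes y: "0 < y" and c: "cos x \<le> c" "c < 1"
  shows "poisson y x \<le> sinh y / (1 - c)"
  unfolding poisson_def using y c cosh_real_ge_1[of y] cosh_minus_cos_pos[OF y, of x]
  by (intro divide_left_mono mult_pos_pos) auto

lemma poisson_commute: "poisson y (x - z) = poisson y (z - x)"
  using cos_minus[of "x - z"] by (simp add: poisson_def)

lemma cos_le_cos_between:
  assumes "0 \<le> \<delta>" "\<delta> \<le> \<bar>u\<bar>" "\<bar>u\<bar> \<le> 2 * pi - \<delta>"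
  shows "cos u \<le> cos \<delta>"
proof (cases "\<bar>u\<bar> \<le> pi")
  case True
  hence "cos \<bar>u\<bar> \<le> cos \<delta>" using assms by (intro cos_monotone_0_pi_le) auto
  thus ?thesis by simp
next
  case False
  hence "cos (2 * pi - \<bar>u\<bar>) \<le> cos \<delta>" using assms by (intro cos_monotone_0_pi_le) auto
  thus ?thesis by (simp add: cos_diff)
qed

text \<open>
  The Poisson integral of the indicator function of \<open>{0..b}\<close>, normalised to have the boundary value
  \<open>2 * pi\<close> there. Half-lines \<open>{..b}\<close> generate the Borel sets and are stable under intersection.
\<close>

definition poisson_cdf :: "real \<Rightarrow> real \<Rightarrow> real \<Rightarrow> real" where
  "poisson_cdf b y x = (\<integral>z. indicator {..b} z * poisson y (x - z) \<partial>circle_measure)"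

lemma integrable_indicator_poisson:
  assumes y: "0 < y" and [measurable]: "A \<in> sets borel"
  shows "integrable circle_measure (\<lambda>z. indicator A z * poisson y (x - z))"
proof (rule Bochner_Integration.integrable_bound[OF integral_poisson(1)[OF y, of "- x"]])
  show "AE z in circle_measure. norm (indicator A z * poisson y (x - z)) \<le> norm (poisson y (z + - x))"
    by (auto simp: indicator_def poisson_commute[of y x])
qed measurable

lemma integral_indicator_poisson_le:
  assumes y: "0 < y" and [measurable]: "A \<in> sets borel"
    and c: "\<And>z. z \<in> A \<Longrightarrow> z \<in> {0..2*pi} \<Longrightarrow> cos (x - z) \<le> c" "c < 1"
  shows "(\<integral>z. indicator A z * poisson y (x - z) \<partial>circle_measure) \<le> 2 * pi * (sinh y / (1 - c))"
proof -
  interpret finite_measure circle_measure by (rule finite_measure_circle)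
  have "(\<integral>z. indicator A z * poisson y (x - z) \<partial>circle_measure) \<le> (\<integral>z. sinh y / (1 - c) \<partial>circle_measure)"
    using poisson_le_off_diagonal[OF y c(1) c(2)] y c(2)
    by (intro integral_mono integrable_indicator_poisson) (auto simp: indicator_def)
  thus ?thesis using measure_circle by simp
qed

lemma poisson_cdf_bounds:
  assumes y: "0 < y" shows "0 \<le> poisson_cdf b y x" "poisson_cdf b y x \<le> 2 * pi"
proof -
  show "0 \<le> poisson_cdf b y x"
    unfolding poisson_cdf_def using poisson_pos[OF y]
    by (intro integral_nonneg_AE AE_I2 mult_nonneg_nonneg) (auto simp: less_imp_le)
  have "poisson_cdf b y x \<le> (\<integral>z. poisson y (z + - x) \<partial>circle_measure)"
    unfolding poisson_cdf_def using poisson_pos[OF y, THEN less_imp_le]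
    by (intro integral_mono integrable_indicator_poisson integral_poisson y) (auto simp: indicator_def poisson_commute[of y x])
  thus "poisson_cdf b y x \<le> 2 * pi" by (simp only: integral_poisson(2)[OF y])
qed

text \<open>
  As \<open>y \<rightarrow> 0\<close> the kernel tends to 0 uniformly away from the multiples of \<open>2 * pi\<close>, so its mass
  concentrates at the diagonal. The ends 0 and \<open>2 * pi\<close> are excluded because there a
  neighbourhood on the circle wraps around.
\<close>

lemma poisson_cdf_tendsto:
  assumes y: "\<And>n. 0 < Y n" "Y \<longlonglongrightarrow> 0" and x: "0 < x" "x < 2 * pi" "x \<noteq> b"
  shows "(\<lambda>n. poisson_cdf b (Y n) x) \<longlonglongrightarrow> 2 * pi * indicator {..b} x"
proof -
  \<comment> \<open>For \<open>z\<close> on the other side of \<open>b\<close>, the distance of \<open>x - z\<close> from \<open>- 2 * pi\<close>, 0 and \<open>2 * pi\<close> is at least \<open>\<delta>\<close>.\<close>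
  define \<delta> where "\<delta> = min \<bar>x - b\<bar> (min x (2 * pi - x))"
  have \<delta>: "0 < \<delta>" "\<delta> \<le> pi" using x by (auto simp: \<delta>_def min_def)
  have c: "cos \<delta> < 1" using \<delta> cos_monotone_0_pi[of 0 \<delta>] by simp
  have le: "cos (x - z) \<le> cos \<delta>" if "\<delta> \<le> \<bar>x - z\<bar>" "z \<in> {0..2*pi}" for z
    using that \<delta> x by (intro cos_le_cos_between) (auto simp: \<delta>_def min_def abs_real_def split: if_splits)
  have lim: "(\<lambda>n. 2 * pi * (sinh (Y n) / (1 - cos \<delta>))) \<longlonglongrightarrow> 2 * pi * (sinh 0 / (1 - cos \<delta>))"
    using c by (intro tendsto_intros y) auto
  show ?thesis
  proof (cases "x < b")
    case False
    have "poisson_cdf b (Y n) x \<le> 2 * pi * (sinh (Y n) / (1 - cos \<delta>))" for n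
      unfolding poisson_cdf_def using False x
      by (intro integral_indicator_poisson_le y c le) (auto simp: \<delta>_def)
    note up = this
    have "(\<lambda>n. poisson_cdf b (Y n) x) \<longlonglongrightarrow> 0"
    proof (rule tendsto_sandwich[OF _ _ tendsto_const])
      show "\<forall>\<^sub>F n in sequentially. 0 \<le> poisson_cdf b (Y n) x"
        by (intro always_eventually allI poisson_cdf_bounds y)
      show "\<forall>\<^sub>F n in sequentially. poisson_cdf b (Y n) x \<le> 2 * pi * (sinh (Y n) / (1 - cos \<delta>))"
        by (intro always_eventually allI up)
      show "(\<lambda>n. 2 * pi * (sinh (Y n) / (1 - cos \<delta>))) \<longlonglongrightarrow> 0" using lim by simp
    qed
    thus ?thesis using False x by simp
  next
    case True
    have e: "poisson_cdf b (Y n) x = 2 * pi - (\<integral>z. indicator {b<..} z * poisson (Y n) (x - z) \<partial>circle_measure)" for n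
    proof -
      have "poisson_cdf b (Y n) x + (\<integral>z. indicator {b<..} z * poisson (Y n) (x - z) \<partial>circle_measure)
        = (\<integral>z. indicator {..b} z * poisson (Y n) (x - z) + indicator {b<..} z * poisson (Y n) (x - z) \<partial>circle_measure)"
        unfolding poisson_cdf_def
        by (intro Bochner_Integration.integral_add[symmetric] integrable_indicator_poisson y) auto
      also have "\<dots> = (\<integral>z. poisson (Y n) (z + - x) \<partial>circle_measure)"
        by (intro Bochner_Integration.integral_cong) (auto simp: indicator_def poisson_commute[of _ x])
      also have "\<dots> = 2 * pi" by (rule integral_poisson(2)[OF y(1)])
      finally show ?thesis by simp
    qed
    have "2 * pi - 2 * pi * (sinh (Y n) / (1 - cos \<delta>)) \<le> poisson_cdf b (Y n) x" for n
    proof -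
      have "(\<integral>z. indicator {b<..} z * poisson (Y n) (x - z) \<partial>circle_measure) \<le> 2 * pi * (sinh (Y n) / (1 - cos \<delta>))"
        using True by (intro integral_indicator_poisson_le y c le) (auto simp: \<delta>_def)
      thus ?thesis unfolding e by simp
    qed
    note lo = this
    have "(\<lambda>n. poisson_cdf b (Y n) x) \<longlonglongrightarrow> 2 * pi"
    proof (rule tendsto_sandwich[OF _ _ _ tendsto_const])
      show "\<forall>\<^sub>F n in sequentially. 2 * pi - 2 * pi * (sinh (Y n) / (1 - cos \<delta>)) \<le> poisson_cdf b (Y n) x"
        by (intro always_eventually allI lo)
      show "\<forall>\<^sub>F n in sequentially. poisson_cdf b (Y n) x \<le> 2 * pi"
        by (intro always_eventually allI poisson_cdf_bounds y)
      show "(\<lambda>n. 2 * pi - 2 * pi * (sinh (Y n) / (1 - cos \<delta>))) \<longlonglongrightarrow> 2 * pi"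
        using tendsto_diff[OF tendsto_const lim, of "2 * pi"] by simp
    qed
    thus ?thesis using True by simp
  qed
qed

text \<open>
  By Fubini the integral is that of the Poisson integrals of \<open>d\<close>, which vanish with all the
  Fourier coefficients.
\<close>

lemma integral_poisson_cdf_eq_0:
  assumes d: "integrable circle_measure d" and coeff: "\<And>\<nu>. fourier_coeff d \<nu> = 0" and y: "0 < y"
  shows "(\<integral>x. d x * poisson_cdf b y x \<partial>circle_measure) = 0"
proof -
  interpret finite_measure circle_measure by (rule finite_measure_circle)
  interpret pair_sigma_finite circle_measure circle_measure ..
  have [measurable]: "d \<in> borel_measurable circle_measure" using d by simp
  have z: "(\<integral>x. d x * poisson y (x - z) \<partial>circle_measure) = 0" for z
  proof -
    have "(\<lambda>n. 0) sums (\<integral>x. d x * poisson y (x - z) \<partial>circle_measure)"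
      using poisson_integral_sums[OF y d, of z] by (simp add: coeff)
    from sums_unique2[OF this sums_zero] show ?thesis .
  qed
  define f where "f x z = d x * complex_of_real (indicator {..b} z * poisson y (x - z))" for x z
  have "integrable (circle_measure \<Otimes>\<^sub>M circle_measure) (\<lambda>u. (1 + 2 / y) * norm (d (fst u)))"
    by (intro integrable_mult_right integrable_pair_fst finite_measure_circle integrable_norm d)
       (intro finite_measure.axioms(1) finite_measure_circle)
  hence "integrable (circle_measure \<Otimes>\<^sub>M circle_measure) (\<lambda>u. f (fst u) (snd u))"
  proof (rule Bochner_Integration.integrable_bound)
    have [measurable]: "(\<lambda>z. fst z) \<in> borel_measurable (circle_measure \<Otimes>\<^sub>M circle_measure)"
      "(\<lambda>z. snd z) \<in> borel_measurable (circle_measure \<Otimes>\<^sub>M circle_measure)"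
      by (rule measurable_compose[OF measurable_fst measurable_ident_circle] measurable_compose[OF measurable_snd measurable_ident_circle])+
    have [measurable]: "(\<lambda>z. d (fst z)) \<in> borel_measurable (circle_measure \<Otimes>\<^sub>M circle_measure)"
      by (rule measurable_compose[OF measurable_fst]) measurable
    show "(\<lambda>u. f (fst u) (snd u)) \<in> borel_measurable (circle_measure \<Otimes>\<^sub>M circle_measure)"
      unfolding f_def by measurable
    show "AE u in circle_measure \<Otimes>\<^sub>M circle_measure. norm (f (fst u) (snd u)) \<le> norm ((1 + 2 / y) * norm (d (fst u)))"
    proof (rule AE_I2)
      fix u
      have "indicator {..b} (snd u) * poisson y (fst u - snd u) \<le> 1 + 2 / y"
        using poisson_le[OF y, of "fst u - snd u"] y by (auto simp: indicator_def)
      moreover have "0 \<le> indicator {..b} (snd u) * poisson y (fst u - snd u)"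
        using poisson_pos[OF y, of "fst u - snd u"] by (auto simp: indicator_def)
      ultimately show "norm (f (fst u) (snd u)) \<le> norm ((1 + 2 / y) * norm (d (fst u)))"
        unfolding f_def norm_mult norm_of_real by (subst mult.commute) (intro mult_mono, auto)
    qed
  qed
  hence "integrable (circle_measure \<Otimes>\<^sub>M circle_measure) (case_prod f)"
    by (simp add: case_prod_beta')
  from Fubini_integral[OF this]
  have "(\<integral>x. \<integral>z. f x z \<partial>circle_measure \<partial>circle_measure) = (\<integral>z. \<integral>x. f x z \<partial>circle_measure \<partial>circle_measure)" by simp
  also have "(\<lambda>z. \<integral>x. f x z \<partial>circle_measure) = (\<lambda>z. 0)"
  proof
    fix z
    have "f x z = indicator {..b} z * (d x * poisson y (x - z))" for x
      by (simp add: f_def indicator_def)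
    thus "(\<integral>x. f x z \<partial>circle_measure) = 0" by (simp add: z)
  qed
  also have "(\<lambda>x. \<integral>z. f x z \<partial>circle_measure) = (\<lambda>x. d x * poisson_cdf b y x)"
    by (simp only: f_def poisson_cdf_def integral_mult_right_zero integral_complex_of_real)
  finally show ?thesis by simp
qed

lemma poisson_cdf_measurable [measurable]: "poisson_cdf b y \<in> borel_measurable circle_measure"
proof -
  interpret finite_measure circle_measure by (rule finite_measure_circle)
  have [measurable]: "(\<lambda>z. fst z) \<in> borel_measurable (circle_measure \<Otimes>\<^sub>M circle_measure)"
      "(\<lambda>z. snd z) \<in> borel_measurable (circle_measure \<Otimes>\<^sub>M circle_measure)"
      by (rule measurable_compose[OF measurable_fst measurable_ident_circle] measurable_compose[OF measurable_snd measurable_ident_circle])+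
  show ?thesis unfolding poisson_cdf_def[abs_def]
    by (rule borel_measurable_lebesgue_integral) measurable
qed

lemma integral_initial_segment_eq_0:
  assumes d: "integrable circle_measure d" and coeff: "\<And>\<nu>. fourier_coeff d \<nu> = 0"
  shows "(\<integral>x. indicator {..b} x *\<^sub>R d x \<partial>circle_measure) = 0"
proof -
  define Y where "Y n = inverse (real (Suc n))" for n
  have Y: "0 < Y n" "Y \<longlonglongrightarrow> 0" for n unfolding Y_def by (simp, rule LIMSEQ_inverse_real_of_nat)
  have [measurable]: "d \<in> borel_measurable circle_measure" using d by simp
  have "(\<lambda>n. \<integral>x. d x * poisson_cdf b (Y n) x \<partial>circle_measure) \<longlonglongrightarrow> (\<integral>x. d x * complex_of_real (2 * pi * indicator {..b} x) \<partial>circle_measure)"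
  proof (rule integral_dominated_convergence[where w = "\<lambda>x. norm (d x) * (2 * pi)"])
    show "integrable circle_measure (\<lambda>x. norm (d x) * (2 * pi))" using d by simp
    show "AE x in circle_measure. (\<lambda>n. d x * poisson_cdf b (Y n) x) \<longlonglongrightarrow> d x * complex_of_real (2 * pi * indicator {..b} x)"
      using AE_circle_neq[of 0] AE_circle_neq[of "2 * pi"] AE_circle_neq[of b] AE_space
    proof eventually_elim
      case (elim x)
      thus ?case using Y by (intro tendsto_intros poisson_cdf_tendsto) auto
    qed
    show "AE x in circle_measure. norm (d x * poisson_cdf b (Y n) x) \<le> norm (d x) * (2 * pi)" for n
      using poisson_cdf_bounds[OF Y(1)] by (auto simp: norm_mult intro!: mult_left_mono AE_I2)
  qed measurable
  hence "0 = (\<integral>x. d x * complex_of_real (2 * pi * indicator {..b} x) \<partial>circle_measure)"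
    by (simp only: integral_poisson_cdf_eq_0[OF d coeff Y(1)] LIMSEQ_const_iff)
  also have "(\<lambda>x. d x * complex_of_real (2 * pi * indicator {..b} x)) = (\<lambda>x. complex_of_real (2 * pi) * (indicator {..b} x *\<^sub>R d x))"
    by (simp add: fun_eq_iff indicator_def)
  also have "(\<integral>x. complex_of_real (2 * pi) * (indicator {..b} x *\<^sub>R d x) \<partial>circle_measure)
      = complex_of_real (2 * pi) * (\<integral>x. indicator {..b} x *\<^sub>R d x \<partial>circle_measure)"
    by (rule integral_mult_right_zero)
  finally show ?thesis by simp
qed

text \<open>
  Uniqueness of Fourier series: the integral of \<open>d\<close> vanishes over initial segments by dominated
  convergence, therefore over all Borel sets by Dynkin's argument, and over Lebesgue sets because these
  differ from Borel sets by null sets.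
\<close>

theorem fourier_coeff_eq_0_imp_AE_eq_0:
  assumes d: "integrable circle_measure d" and coeff: "\<And>\<nu>. fourier_coeff d \<nu> = 0"
  shows "AE x in circle_measure. d x = 0"
proof -
  interpret finite_measure circle_measure by (rule finite_measure_circle)
  show ?thesis
  proof (rule density_zero[OF d])
  have borel: "set_lebesgue_integral circle_measure B d = 0" if "B \<in> sets borel" for B
  proof -
    have meas: "B \<in> sets borel \<Longrightarrow> set_integrable circle_measure B d" for B
      unfolding set_integrable_def scaleR_conv_of_real mult.commute[of _ "d _"]
      by (intro integrable_bounded_mult[OF d, where B = 1]) (auto simp: indicator_def)
    have total: "integral\<^sup>L circle_measure d = 0"
      using coeff[of 0] by (simp add: fourier_coeff_def)
    have sb: "sets borel = sigma_sets UNIV (range (\<lambda>b::real. {..b}))"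
      by (subst borel_eq_atMost) simp
    have mem: "B \<in> sigma_sets UNIV (range (\<lambda>b::real. {..b}))" using that by (simp only: sb)
    have stable: "Int_stable (range (\<lambda>b::real. {..b}))" by (auto simp: Int_stable_def)
    have sub: "range (\<lambda>b::real. {..b}) \<subseteq> Pow UNIV" by simp
    from stable sub mem show ?thesis
    proof (induction rule: sigma_sets_induct_disjoint)
      case (basic A)
      thus ?case using integral_initial_segment_eq_0[OF d coeff] by (auto simp: set_lebesgue_integral_def)
    next
      case empty
      show ?case by (simp add: set_lebesgue_integral_def)
    next
      case (compl A)
      have A: "A \<in> sets borel" using compl(1) by (simp only: sb)
      have "(\<lambda>x. indicator (UNIV - A) x *\<^sub>R d x) = (\<lambda>x. d x - indicator A x *\<^sub>R d x)"
        by (auto simp: indicator_def)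
      thus ?case using compl(2) meas[OF A] d total by (simp add: set_lebesgue_integral_def set_integrable_def)
    next
      case (union A)
      have A: "A i \<in> sets borel" for i using union(2) unfolding sb by auto
      have "set_lebesgue_integral circle_measure (\<Union>i. A i \<inter> {0..2*pi}) d = (\<Sum>i. set_lebesgue_integral circle_measure (A i \<inter> {0..2*pi}) d)"
      proof (rule lebesgue_integral_countable_add)
        show "A i \<inter> {0..2*pi} \<in> sets circle_measure" for i
          using A[of i] by (auto simp: sets_restrict_space intro!: image_eqI[of _ _ "A i"])
        show "set_integrable circle_measure (\<Union>i. A i \<inter> {0..2*pi}) d"
          by (intro meas) (use A in auto)
      qed (use union(1) in \<open>auto simp: disjoint_family_on_def\<close>)
      moreover have "set_lebesgue_integral circle_measure (C \<inter> {0..2*pi}) d = set_lebesgue_integral circle_measure C d" for C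
        unfolding set_lebesgue_integral_def by (intro Bochner_Integration.integral_cong) (auto simp: indicator_def)
      ultimately show ?case using union(3) by (simp flip: UN_extend_simps)
    qed
  qed
  fix A assume "A \<in> sets circle_measure"
  then obtain A' where A': "A' \<in> sets lebesgue" "A = A' \<inter> {0..2*pi}"
    by (auto simp: sets_restrict_space)
  then obtain S N N' where SN: "A' = S \<union> N" "N \<subseteq> N'" "N' \<in> null_sets lborel" "S \<in> sets lborel"
    by (elim sets_completionE)
  have "AE x in lebesgue. x \<notin> N'" using AE_not_in[OF SN(3)] by (rule AE_completion)
  hence "AE x in circle_measure. x \<notin> N'" by (subst AE_restrict_space_iff) auto
  hence "AE x in circle_measure. indicator A x *\<^sub>R d x = indicator S x *\<^sub>R d x"
    using AE_space by eventually_elim (use A' SN in \<open>auto simp: indicator_def\<close>)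
  moreover have "(\<lambda>x. indicator A x *\<^sub>R d x) \<in> borel_measurable circle_measure"
    using d \<open>A \<in> sets circle_measure\<close> by measurable
  moreover have "(\<lambda>x. indicator S x *\<^sub>R d x) \<in> borel_measurable circle_measure"
    using d SN(4) by measurable
  ultimately have "set_lebesgue_integral circle_measure A d = set_lebesgue_integral circle_measure S d"
    unfolding set_lebesgue_integral_def by (intro integral_cong_AE)
  thus "set_lebesgue_integral circle_measure A d = 0" using borel[of S] SN(4) by simp
  qed
qed

section \<open>Superpositions of Poisson kernels in Lp\<close>

text \<open>
  The weight for the superposition over the scales \<open>y\<close>. At scales above \<open>\<eta>\<close>, the size of the
  translation, the increment estimate gains the factor \<open>\<eta> / y\<close>. The total weight is a constant
  times \<open>\<eta> powr t\<close>; convergence at 0 uses \<open>t > 0\<close> and convergence at infinity uses \<open>t < 1\<close>.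
\<close>

definition scale_weight :: "real \<Rightarrow> real \<Rightarrow> real \<Rightarrow> real" where
  "scale_weight t \<eta> y = indicator {0<..} y * (y powr (t - 1) * min 1 (\<eta> / y))"

lemma scale_weight_nonneg: "0 < \<eta> \<Longrightarrow> 0 \<le> scale_weight t \<eta> y"
  by (auto simp: scale_weight_def indicator_def)

lemma scale_weight_measurable [measurable]: "scale_weight t \<eta> \<in> borel_measurable borel"
  unfolding scale_weight_def by measurable

lemma scale_weight_integral:
  assumes t: "0 < t" "t < 1" and \<eta>: "0 < \<eta>"
  shows "integrable lborel (scale_weight t \<eta>)"
    and "integral\<^sup>L lborel (scale_weight t \<eta>) \<le> (1 / t + 1 / (1 - t)) * \<eta> powr t"
proof -
  have i1: "(\<integral>\<^sup>+y. ennreal (indicator {0..\<eta>} y * y powr (t - 1)) \<partial>lborel) = ennreal (\<eta> powr t / t)"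
    using t \<eta> has_integral_powr_from_0[of "t - 1" \<eta>]
    by (intro nn_integral_has_integral_lebesgue) auto
  have i2: "(\<integral>\<^sup>+y. ennreal (indicator {\<eta>..} y * y powr (t - 2)) \<partial>lborel) = ennreal (\<eta> powr (t - 1) / (1 - t))"
  proof (intro nn_integral_has_integral_lebesgue)
    have "- (\<eta> powr (t - 2 + 1)) / (t - 2 + 1) = \<eta> powr (t - 1) / (1 - t)"
      using t by (simp add: divide_simps) (simp add: algebra_simps)
    thus "((\<lambda>y. y powr (t - 2)) has_integral \<eta> powr (t - 1) / (1 - t)) {\<eta>..}"
      using t \<eta> has_integral_powr_to_inf[of "t - 2" \<eta>] by simp
  qed auto
  have "ennreal (scale_weight t \<eta> y) \<le> ennreal (indicator {0..\<eta>} y * y powr (t - 1)) + ennreal \<eta> * ennreal (indicator {\<eta>..} y * y powr (t - 2))" for y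
  proof (cases "0 < y")
    case True
    have "y powr (t - 2) * y = y powr (t - 1)" using True by (simp add: powr_mult_base mult.commute)
    hence "scale_weight t \<eta> y \<le> indicator {0..\<eta>} y * y powr (t - 1) + \<eta> * (indicator {\<eta>..} y * y powr (t - 2))"
      using True \<eta> by (cases "y \<le> \<eta>") (auto simp: scale_weight_def min_def field_simps)
    thus ?thesis using \<eta> by (simp add: ennreal_leI flip: ennreal_mult ennreal_plus)
  qed (simp add: scale_weight_def)
  hence "(\<integral>\<^sup>+y. ennreal (scale_weight t \<eta> y) \<partial>lborel) \<le> (\<integral>\<^sup>+y. ennreal (indicator {0..\<eta>} y * y powr (t - 1)) + ennreal \<eta> * ennreal (indicator {\<eta>..} y * y powr (t - 2)) \<partial>lborel)"
    by (intro nn_integral_mono)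
  also have "\<dots> = ennreal (\<eta> powr t / t) + ennreal \<eta> * ennreal (\<eta> powr (t - 1) / (1 - t))"
    by (subst nn_integral_add) (auto simp: i1 i2 nn_integral_cmult)
  also have "\<dots> = ennreal ((1 / t + 1 / (1 - t)) * \<eta> powr t)"
  proof -
    have "\<eta> * \<eta> powr (t - 1) = \<eta> powr t" using \<eta> by (simp add: powr_mult_base)
    thus ?thesis using t \<eta> 
      by (simp add: distrib_right flip: ennreal_mult ennreal_plus)
  qed
  finally have le: "(\<integral>\<^sup>+y. ennreal (scale_weight t \<eta> y) \<partial>lborel) \<le> ennreal ((1 / t + 1 / (1 - t)) * \<eta> powr t)" .
  show int: "integrable lborel (scale_weight t \<eta>)"
    using le scale_weight_nonneg[OF \<eta>] by (intro integrableI_bounded) (auto simp: le_less_trans)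
  have "ennreal (integral\<^sup>L lborel (scale_weight t \<eta>)) \<le> ennreal ((1 / t + 1 / (1 - t)) * \<eta> powr t)"
    using le scale_weight_nonneg[OF \<eta>] by (subst (asm) nn_integral_eq_integral[OF int]) auto
  thus "integral\<^sup>L lborel (scale_weight t \<eta>) \<le> (1 / t + 1 / (1 - t)) * \<eta> powr t"
    using t \<eta> by (subst (asm) ennreal_le_iff) auto
qed

text \<open>
  As \<open>\<integral> y powr b * exp (- n * y) = Gamma (b + 1) * n powr (- b - 1)\<close> over \<open>y > 0\<close>, this is a
  representation of \<open>2 * Gamma (b + 1) * (\<Sum>n\<ge>1. n powr (- b - 1) * cos (n * x))\<close>.
\<close>

definition riesz_kernel :: "real \<Rightarrow> real \<Rightarrow> real" where
  "riesz_kernel b x = (\<integral>y. indicator {0<..} y * (y powr b * (poisson y x - 1)) \<partial>lborel)"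

lemma measurable_circle_pair [measurable]: "(\<lambda>z. fst z) \<in> borel_measurable (circle_measure \<Otimes>\<^sub>M N)"
  by (rule measurable_compose[OF measurable_fst measurable_ident_circle])

text \<open>
  Apart from the gain \<open>min 1 (\<eta> / y)\<close>, the second factor of the weight, the situation at scale \<open>y\<close> is this:
  pointwise size \<open>c / y\<close> together with bounded mean over the circle gives, by interpolation, an
  \<open>L\<^sup>p\<close> norm of order \<open>y powr (1 / p - 1)\<close>. Multiplied by \<open>y powr (t - 1 / p)\<close> this is
  \<open>y powr (t - 1)\<close>, the first factor of the weight, and Minkowski's inequality applies.
\<close>

lemma superposition_bound:
  fixes G Q :: "real \<Rightarrow> real \<Rightarrow> real"
  assumes p: "1 < p" and t: "0 < t" "t < 1" and \<eta>: "0 < \<eta>" and c: "0 < c"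
    and G [measurable]: "(\<lambda>(x, y). G x y) \<in> borel_measurable (circle_measure \<Otimes>\<^sub>M lborel)"
    and Gc: "\<And>x y. 0 < y \<Longrightarrow> y * \<bar>G x y\<bar> \<le> c * min 1 (\<eta> / y)"
    and GQ: "\<And>x y. 0 < y \<Longrightarrow> \<bar>G x y\<bar> \<le> c * min 1 (\<eta> / y) * Q x y"
    and Qm: "\<And>y. (\<lambda>x. Q x y) \<in> borel_measurable circle_measure"
    and Q: "\<And>y. 0 < y \<Longrightarrow> (\<integral>\<^sup>+x. ennreal (Q x y) \<partial>circle_measure) \<le> ennreal L" and L: "0 \<le> L"
  shows "integrable (circle_measure \<Otimes>\<^sub>M lborel) (\<lambda>(x, y). indicator {0<..} y * (y powr (t - 1 / p) * G x y))"
    and "AE x in circle_measure. integrable lborel (\<lambda>y. indicator {0<..} y * (y powr (t - 1 / p) * G x y))"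
    and "(\<integral>\<^sup>+x. ennreal (\<bar>\<integral>y. indicator {0<..} y * (y powr (t - 1 / p) * G x y) \<partial>lborel\<bar> powr p) \<partial>circle_measure)
          \<le> ennreal (L * (c * (1 / t + 1 / (1 - t)) * \<eta> powr t) powr p)"
proof -
  \<comment> \<open>The quotient of the integrand by the weight, simplified.\<close>
  define V where "V x y = y powr (1 - 1 / p) * G x y / min 1 (\<eta> / y)" for x y
  have V[measurable]: "(\<lambda>(x, y). V x y) \<in> borel_measurable (circle_measure \<Otimes>\<^sub>M lborel)"
    unfolding V_def by measurable
  have eq: "scale_weight t \<eta> y * V x y = indicator {0<..} y * (y powr (t - 1 / p) * G x y)" for x y
  proof (cases "0 < y")
    case True
    have "y powr (t - 1) * y powr (1 - 1 / p) = y powr (t - 1 / p)"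
      by (simp flip: powr_add)
    moreover have "min 1 (\<eta> / y) > 0" using True \<eta> by simp
    ultimately show ?thesis by (simp add: scale_weight_def V_def True)
  qed (simp add: scale_weight_def)
  have bound: "(\<integral>\<^sup>+x. ennreal (\<bar>V x y\<bar> powr p) \<partial>circle_measure) \<le> ennreal (L * c powr p)"
    if "scale_weight t \<eta> y \<noteq> 0" for y
  proof -
    have y: "0 < y" using that by (auto simp: scale_weight_def indicator_def split: if_splits)
    define m where "m = min 1 (\<eta> / y)"
    have m: "m > 0" using y \<eta> by (simp add: m_def)
    have "\<bar>V x y\<bar> powr p \<le> c powr p * Q x y" for x
    proof -
      define a where "a = \<bar>G x y\<bar> / m"
      have a: "0 \<le> a" "y * a \<le> c" "a \<le> c * Q x y"
        using Gc[OF y, of x] GQ[OF y, of x] m by (auto simp: a_def m_def[symmetric] field_simps)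
      have "\<bar>V x y\<bar> = y powr (1 - 1 / p) * a"
        using m by (simp add: V_def m_def[symmetric] a_def abs_mult)
      hence "\<bar>V x y\<bar> powr p = y powr (p - 1) * a powr p"
        using p a by (simp add: powr_mult powr_powr algebra_simps)
      also have "\<dots> = (y * a) powr (p - 1) * a"
        using a y by (cases "a = 0") (auto simp: powr_mult powr_mult_base mult_ac)
      also have "\<dots> \<le> c powr (p - 1) * (c * Q x y)"
        using a y p by (intro mult_mono powr_mono2) auto
      also have "\<dots> = c powr p * Q x y"
        using c by (simp add: powr_mult_base mult_ac)
      finally show ?thesis .
    qed
    hence "(\<integral>\<^sup>+x. ennreal (\<bar>V x y\<bar> powr p) \<partial>circle_measure) \<le> (\<integral>\<^sup>+x. ennreal (c powr p * Q x y) \<partial>circle_measure)"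
      by (intro nn_integral_mono ennreal_leI)
    also have "\<dots> = ennreal (c powr p) * (\<integral>\<^sup>+x. ennreal (Q x y) \<partial>circle_measure)"
      using Qm by (simp add: ennreal_mult' nn_integral_cmult)
    also have "\<dots> \<le> ennreal (c powr p) * ennreal L"
      by (intro mult_left_mono Q y) auto
    also have "\<dots> = ennreal (L * c powr p)" by (simp add: ennreal_mult' L mult.commute)
    finally show ?thesis .
  qed
  note M = minkowski_powr_integral[OF finite_measure_circle sigma_finite_lborel p scale_weight_integral(1)[OF t \<eta>] scale_weight_nonneg[OF \<eta>] _ V bound, unfolded eq]
  have K: "0 \<le> L * c powr p" using L by simp
  show "integrable (circle_measure \<Otimes>\<^sub>M lborel) (\<lambda>(x, y). indicator {0<..} y * (y powr (t - 1 / p) * G x y))"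
    using M(1)[OF K] .
  show "AE x in circle_measure. integrable lborel (\<lambda>y. indicator {0<..} y * (y powr (t - 1 / p) * G x y))"
    using M(2)[OF K] .
  have "(\<integral>\<^sup>+x. ennreal (\<bar>\<integral>y. indicator {0<..} y * (y powr (t - 1 / p) * G x y) \<partial>lborel\<bar> powr p) \<partial>circle_measure)
    \<le> ennreal (L * c powr p * integral\<^sup>L lborel (scale_weight t \<eta>) powr p)"
    using M(3)[OF K] .
  also have "\<dots> \<le> ennreal (L * c powr p * ((1 / t + 1 / (1 - t)) * \<eta> powr t) powr p)"
    using scale_weight_integral(2)[OF t \<eta>] scale_weight_nonneg[OF \<eta>] L p
    by (intro ennreal_leI mult_left_mono powr_mono2) (auto intro!: integral_nonneg)
  also have "\<dots> = ennreal (L * (c * (1 / t + 1 / (1 - t)) * \<eta> powr t) powr p)"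
    using c t by (simp add: powr_mult mult.assoc)
  finally show "(\<integral>\<^sup>+x. ennreal (\<bar>\<integral>y. indicator {0<..} y * (y powr (t - 1 / p) * G x y) \<partial>lborel\<bar> powr p) \<partial>circle_measure)
          \<le> ennreal (L * (c * (1 / t + 1 / (1 - t)) * \<eta> powr t) powr p)" .
qed

text \<open>
  The \<open>L\<^sup>p\<close> bound is uniform in the shift \<open>h\<close>; applied to \<open>h\<close> and to 0, it controls the increments
  of the kernel at large \<open>h\<close>. The integrability statements justify Fubini's theorem and the
  subtraction of the two integrals in an increment.
\<close>

lemma riesz_kernel_shift_Lp:
  assumes p: "1 < p" and t: "0 < t" "t < 1"
  shows "integrable (circle_measure \<Otimes>\<^sub>M lborel) (\<lambda>(x, y). indicator {0<..} y * (y powr (t - 1 / p) * (poisson y (x + h) - 1)))"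
    and "AE x in circle_measure. integrable lborel (\<lambda>y. indicator {0<..} y * (y powr (t - 1 / p) * (poisson y (x + h) - 1)))"
    and "(\<integral>\<^sup>+x. ennreal (\<bar>riesz_kernel (t - 1 / p) (x + h)\<bar> powr p) \<partial>circle_measure)
          \<le> ennreal (4 * pi * (4 * (1 / t + 1 / (1 - t))) powr p)"
proof -
  interpret finite_measure circle_measure by (rule finite_measure_circle)
  have Q: "(\<integral>\<^sup>+x. ennreal (poisson y (x + h) + 1) \<partial>circle_measure) \<le> ennreal (4 * pi)" if y: "0 < y" for y
  proof -
    have "(\<integral>\<^sup>+x. ennreal (poisson y (x + h) + 1) \<partial>circle_measure) = (\<integral>\<^sup>+x. ennreal (poisson y (x + h)) + 1 \<partial>circle_measure)"
      using poisson_pos[OF y] by (intro nn_integral_cong) (simp add: ennreal_plus less_imp_le)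
    also have "\<dots> = ennreal (2 * pi) + ennreal (2 * pi)"
      using measure_circle by (subst nn_integral_add) (auto simp: integral_poisson[OF y] emeasure_eq_measure)
    finally show ?thesis by (simp flip: ennreal_plus)
  qed
  have Gc: "y * \<bar>poisson y (x + h) - 1\<bar> \<le> 4 * min 1 (1 / y)" if y: "0 < y" for x y
    using poisson_shift_bound[OF y, of "x + h"] y by (auto simp: min_def field_simps power2_eq_square)
  have GQ: "\<bar>poisson y (x + h) - 1\<bar> \<le> 4 * min 1 (1 / y) * (poisson y (x + h) + 1)" if y: "0 < y" for x y
  proof (cases "y \<le> 1")
    case True
    thus ?thesis using poisson_pos[OF y, of "x + h"] y by (simp add: min_def)
  next
    case False
    have "\<bar>poisson y (x + h) - 1\<bar> \<le> 2 / y * 1" using poisson_shift_bound(1)[OF y] by simp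
    also have "\<dots> \<le> 4 / y * (poisson y (x + h) + 1)"
      using poisson_pos[OF y, of "x + h"] y by (intro mult_mono) (auto intro: divide_right_mono)
    finally show ?thesis using False by (simp add: min_def)
  qed
  have G: "(\<lambda>(x, y). poisson y (x + h) - 1) \<in> borel_measurable (circle_measure \<Otimes>\<^sub>M lborel)"
    by measurable
  note S = superposition_bound[OF p t zero_less_one _ G Gc GQ _ Q]
  show "integrable (circle_measure \<Otimes>\<^sub>M lborel) (\<lambda>(x, y). indicator {0<..} y * (y powr (t - 1 / p) * (poisson y (x + h) - 1)))"
    by (rule S(1)) auto
  show "AE x in circle_measure. integrable lborel (\<lambda>y. indicator {0<..} y * (y powr (t - 1 / p) * (poisson y (x + h) - 1)))"
    by (rule S(2)) auto
  show "(\<integral>\<^sup>+x. ennreal (\<bar>riesz_kernel (t - 1 / p) (x + h)\<bar> powr p) \<partial>circle_measure)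
          \<le> ennreal (4 * pi * (4 * (1 / t + 1 / (1 - t))) powr p)"
    using S(3) by (simp add: riesz_kernel_def)
qed

text \<open>
  The Besov estimate of order \<open>t\<close>. For \<open>y \<le> \<bar>h\<bar>\<close> the two kernels are estimated separately, for
  \<open>y > \<bar>h\<bar>\<close> the increment estimate gains \<open>\<bar>h\<bar> / y\<close>; the constant 24 covers both cases.
\<close>

lemma riesz_kernel_increment_Lp:
  assumes p: "1 < p" and t: "0 < t" "t < 1" and h: "h \<noteq> 0"
  shows "(\<integral>\<^sup>+x. ennreal (\<bar>riesz_kernel (t - 1 / p) (x + h) - riesz_kernel (t - 1 / p) x\<bar> powr p) \<partial>circle_measure)
          \<le> ennreal (4 * pi * (24 * (1 / t + 1 / (1 - t)) * \<bar>h\<bar> powr t) powr p)"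
proof -
  define G where "G x y = poisson y (x + h) - poisson y x" for x y
  have Q: "(\<integral>\<^sup>+x. ennreal (poisson y (x + h) + poisson y x) \<partial>circle_measure) \<le> ennreal (4 * pi)" if y: "0 < y" for y
  proof -
    have "(\<integral>\<^sup>+x. ennreal (poisson y (x + h) + poisson y x) \<partial>circle_measure) = (\<integral>\<^sup>+x. ennreal (poisson y (x + h)) + ennreal (poisson y x) \<partial>circle_measure)"
      using poisson_pos[OF y] by (intro nn_integral_cong) (simp add: ennreal_plus less_imp_le)
    also have "\<dots> = ennreal (2 * pi) + ennreal (2 * pi)"
      using integral_poisson(3)[OF y, of 0] by (subst nn_integral_add) (auto simp: integral_poisson[OF y])
    finally show ?thesis by (simp flip: ennreal_plus)
  qed
  have *: "y * \<bar>G x y\<bar> \<le> 24 * min 1 (\<bar>h\<bar> / y) \<and> \<bar>G x y\<bar> \<le> 24 * min 1 (\<bar>h\<bar> / y) * (poisson y (x + h) + poisson y x)" if y: "0 < y" for x y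
  proof (cases "y \<le> \<bar>h\<bar>")
    case True
    hence m: "min 1 (\<bar>h\<bar> / y) = 1" using y by (simp add: min_def)
    have "\<bar>G x y\<bar> \<le> 2 / y + 2 / y"
      using poisson_shift_bound(1)[OF y, of "x + h"] poisson_shift_bound(1)[OF y, of x] by (simp add: G_def)
    hence "y * \<bar>G x y\<bar> \<le> 4" using y by (simp add: field_simps)
    moreover have "\<bar>G x y\<bar> \<le> 24 * (poisson y (x + h) + poisson y x)"
      using poisson_pos[OF y, of x] poisson_pos[OF y, of "x + h"] by (simp add: G_def)
    ultimately show ?thesis by (simp add: m)
  next
    case False
    hence m: "min 1 (\<bar>h\<bar> / y) = \<bar>h\<bar> / y" using y by (simp add: min_def)
    have s: "sinh y > 0" using y by simp
    have P: "poisson y x > 0" "poisson y (x + h) > 0" using y by (auto intro: poisson_pos)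
    have D: "\<bar>G x y\<bar> \<le> 4 * \<bar>h\<bar> / sinh y * poisson y x"
      using poisson_increment[OF y, of h x] False by (simp add: G_def)
    have "y * (y * poisson y x) \<le> y * (y + 2)"
      using poisson_le[OF y, of x] y by (intro mult_left_mono) (auto simp: field_simps)
    also have "\<dots> \<le> 6 * sinh y"
      using sinh_ge[of y] y by (simp add: distrib_left power2_eq_square)
    finally have a: "y * (y * poisson y x) \<le> 6 * sinh y" .
    have "y * \<bar>G x y\<bar> \<le> y * (4 * \<bar>h\<bar> / sinh y * poisson y x)"
      using D y by (intro mult_left_mono) auto
    also have "\<dots> = 4 * (\<bar>h\<bar> / y) * (y * (y * poisson y x) / sinh y)"
      using y by simp
    also have "\<dots> \<le> 4 * (\<bar>h\<bar> / y) * 6"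
      using a s y by (intro mult_left_mono) (auto simp: field_simps)
    finally have 1: "y * \<bar>G x y\<bar> \<le> 24 * (\<bar>h\<bar> / y)" by simp
    have "4 * \<bar>h\<bar> / sinh y \<le> 24 * (\<bar>h\<bar> / y)"
      using sinh_ge(1)[of y] y s by (simp add: frac_le)
    hence "\<bar>G x y\<bar> \<le> 24 * (\<bar>h\<bar> / y) * poisson y x"
      using D P by (meson mult_right_mono less_imp_le order_trans)
    also have "\<dots> \<le> 24 * (\<bar>h\<bar> / y) * (poisson y (x + h) + poisson y x)"
      using P y by (intro mult_left_mono) auto
    finally show ?thesis using 1 by (simp only: m)
  qed
  have G: "(\<lambda>(x, y). G x y) \<in> borel_measurable (circle_measure \<Otimes>\<^sub>M lborel)"
    unfolding G_def by measurable
  have "(\<integral>\<^sup>+x. ennreal (\<bar>\<integral>y. indicator {0<..} y * (y powr (t - 1 / p) * G x y) \<partial>lborel\<bar> powr p) \<partial>circle_measure)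
          \<le> ennreal (4 * pi * (24 * (1 / t + 1 / (1 - t)) * \<bar>h\<bar> powr t) powr p)"
    using * by (intro superposition_bound(3)[OF p t _ _ G _ _ _ Q]) (use h in auto)
  also have "(\<integral>\<^sup>+x. ennreal (\<bar>\<integral>y. indicator {0<..} y * (y powr (t - 1 / p) * G x y) \<partial>lborel\<bar> powr p) \<partial>circle_measure)
    = (\<integral>\<^sup>+x. ennreal (\<bar>riesz_kernel (t - 1 / p) (x + h) - riesz_kernel (t - 1 / p) x\<bar> powr p) \<partial>circle_measure)"
  proof (rule nn_integral_cong_AE)
    show "AE x in circle_measure. ennreal (\<bar>\<integral>y. indicator {0<..} y * (y powr (t - 1 / p) * G x y) \<partial>lborel\<bar> powr p)
      = ennreal (\<bar>riesz_kernel (t - 1 / p) (x + h) - riesz_kernel (t - 1 / p) x\<bar> powr p)"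
      using riesz_kernel_shift_Lp(2)[OF p t, of h] riesz_kernel_shift_Lp(2)[OF p t, of 0]
    proof eventually_elim
      case (elim x)
      have "riesz_kernel (t - 1 / p) (x + h) - riesz_kernel (t - 1 / p) x
        = (\<integral>y. indicator {0<..} y * (y powr (t - 1 / p) * (poisson y (x + h) - 1)) - indicator {0<..} y * (y powr (t - 1 / p) * (poisson y x - 1)) \<partial>lborel)"
        using elim by (simp add: riesz_kernel_def)
      also have "\<dots> = (\<integral>y. indicator {0<..} y * (y powr (t - 1 / p) * G x y) \<partial>lborel)"
        by (simp add: G_def algebra_simps)
      finally show ?case by simp
    qed
  qed
  finally show ?thesis .
qed

section \<open>The Fourier coefficients of the superposition\<close>

lemma riesz_kernel_periodic: "riesz_kernel b (x + 2 * pi) = riesz_kernel b x"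
  by (simp add: riesz_kernel_def poisson_def)

lemma riesz_kernel_measurable [measurable]: "riesz_kernel b \<in> borel_measurable borel"
  unfolding riesz_kernel_def[abs_def] by measurable

lemma integral_powr_exp_minus:
  fixes a n :: real
  assumes a: "0 < a" and n: "0 < n"
  shows "(\<integral>y. indicator {0<..} y * (y powr (a - 1) * exp (- y * n)) \<partial>lborel) = Gamma a * n powr (- a)"
proof -
  define \<phi> :: "real \<Rightarrow> real" where "\<phi> y = indicator {0<..} y * (y powr (a - 1) * exp (- y))" for y
  have [measurable]: "\<phi> \<in> borel_measurable borel" unfolding \<phi>_def by measurable
  have "(\<integral>\<^sup>+y. ennreal (\<phi> y) \<partial>lborel) = (\<integral>\<^sup>+t. ennreal (indicator {0..} t * t powr (a - 1) / exp t) \<partial>lborel)"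
    by (intro nn_integral_cong) (auto simp: \<phi>_def indicator_def exp_minus field_simps not_less)
  hence nn: "(\<integral>\<^sup>+y. ennreal (\<phi> y) \<partial>lborel) = ennreal (Gamma a)"
    using Gamma_conv_nn_integral_real[OF a] by simp
  have "integral\<^sup>L lborel \<phi> = enn2real (\<integral>\<^sup>+y. ennreal (\<phi> y) \<partial>lborel)"
    by (intro integral_eq_nn_integral) (auto simp: \<phi>_def)
  hence "Gamma a = integral\<^sup>L lborel \<phi>"
    using Gamma_real_nonneg[of a] a by (simp add: nn)
  also have "\<dots> = n * (\<integral>y. \<phi> (n * y) \<partial>lborel)"
    using lborel_integral_real_affine[of n \<phi> 0] n by simp
  also have "(\<lambda>y. \<phi> (n * y)) = (\<lambda>y. n powr (a - 1) * (indicator {0<..} y * (y powr (a - 1) * exp (- y * n))))"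
    using n by (auto simp: fun_eq_iff \<phi>_def indicator_def powr_mult zero_less_mult_iff mult_ac)
  also have "n * (\<integral>y. n powr (a - 1) * (indicator {0<..} y * (y powr (a - 1) * exp (- y * n))) \<partial>lborel)
      = n powr a * (\<integral>y. indicator {0<..} y * (y powr (a - 1) * exp (- y * n)) \<partial>lborel)"
    by (subst integral_mult_right_zero) (use powr_mult_base[of n "a - 1"] n in \<open>simp flip: mult.assoc\<close>)
  finally show ?thesis using n by (simp add: powr_minus field_simps)
qed

lemma riesz_kernel_fourier:
  assumes p: "1 < p" and t: "0 < t" "t < 1"
  shows "(\<integral>x. complex_of_real (riesz_kernel (t - 1 / p) x) * cis (- (of_int \<nu> * x)) \<partial>circle_measure)
    = (if \<nu> = 0 then 0 else complex_of_real (2 * pi * Gamma (t + 1 - 1 / p) * \<bar>of_int \<nu>\<bar> powr (- (t + 1 - 1 / p))))"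
proof -
  interpret finite_measure circle_measure by (rule finite_measure_circle)
  interpret pair_sigma_finite circle_measure lborel ..
  define b where "b = t - 1 / p"
  have "1 / p < 1" using p by simp
  hence a: "0 < b + 1" using t unfolding b_def by linarith
  define k where "k x y = indicator {0<..} y * (y powr b * (poisson y x - 1))" for x y
  have k: "integrable (circle_measure \<Otimes>\<^sub>M lborel) (\<lambda>(x, y). k x y)"
    using riesz_kernel_shift_Lp(1)[OF p t, of 0] by (simp add: k_def b_def)
  define f where "f x y = complex_of_real (k x y) * cis (- (of_int \<nu> * x))" for x y
  have "integrable (circle_measure \<Otimes>\<^sub>M lborel) (\<lambda>z. f (fst z) (snd z))"
  proof (rule Bochner_Integration.integrable_bound[OF k])
    show "(\<lambda>z. f (fst z) (snd z)) \<in> borel_measurable (circle_measure \<Otimes>\<^sub>M lborel)"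
      unfolding f_def k_def by measurable
  qed (auto simp: f_def norm_mult)
  hence "integrable (circle_measure \<Otimes>\<^sub>M lborel) (case_prod f)" by (simp add: case_prod_beta')
  note F = Fubini_integral[OF this]
  have "(\<integral>x. complex_of_real (riesz_kernel b x) * cis (- (of_int \<nu> * x)) \<partial>circle_measure)
    = (\<integral>x. \<integral>y. f x y \<partial>lborel \<partial>circle_measure)"
    unfolding f_def by (simp only: integral_mult_left_zero integral_complex_of_real riesz_kernel_def k_def)
  also have "\<dots> = (\<integral>y. \<integral>x. f x y \<partial>circle_measure \<partial>lborel)" by (rule F[symmetric])
  also have "(\<lambda>y. \<integral>x. f x y \<partial>circle_measure) = (\<lambda>y. complex_of_real (indicator {0<..} y * (y powr b * (2 * pi * (exp (- y * \<bar>of_int \<nu>\<bar>) - (if \<nu> = 0 then 1 else 0))))))"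
  proof
    fix y :: real
    show "(\<integral>x. f x y \<partial>circle_measure) = complex_of_real (indicator {0<..} y * (y powr b * (2 * pi * (exp (- y * \<bar>of_int \<nu>\<bar>) - (if \<nu> = 0 then 1 else 0)))))"
    proof (cases "0 < y")
      case True
      have i0: "integrable circle_measure (\<lambda>x. cis (of_int (- \<nu>) * x))"
        by (intro integrable_const_bound[where B = 1]) auto
      have "norm (complex_of_real (poisson y x)) \<le> 1 + 2 / y" for x
        using poisson_pos[OF True, of x] poisson_le[OF True, of x] by simp
      hence i1: "integrable circle_measure (\<lambda>x. cis (of_int (- \<nu>) * x) * poisson y x)"
        by (intro integrable_bounded_mult[OF i0]) auto
      have "f x y = complex_of_real (y powr b) * (cis (of_int (- \<nu>) * x) * poisson y x - cis (of_int (- \<nu>) * x))" for x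
        using True by (simp add: f_def k_def algebra_simps)
      hence "(\<integral>x. f x y \<partial>circle_measure) = complex_of_real (y powr b) * ((\<integral>x. cis (of_int (- \<nu>) * x) * poisson y x \<partial>circle_measure) - (\<integral>x. cis (of_int (- \<nu>) * x) \<partial>circle_measure))"
        by (simp only: integral_mult_right_zero Bochner_Integration.integral_diff[OF i1 i0])
      also have "(\<integral>x. cis (of_int (- \<nu>) * x) * poisson y x \<partial>circle_measure) = 2 * pi * exp (- y * \<bar>of_int \<nu>\<bar>)"
        using integral_cis_poisson[OF True, of "- \<nu>" 0] by simp
      also have "(\<integral>x. cis (of_int (- \<nu>) * x) \<partial>circle_measure) = 2 * pi * (if \<nu> = 0 then 1 else 0)"
        using fourier_coeff_cis[of "- \<nu>" 0] by (simp add: fourier_coeff_def split: if_splits)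
      finally show ?thesis using True by (simp add: algebra_simps)
    qed (simp add: f_def k_def)
  qed
  also have "(\<integral>y. complex_of_real (indicator {0<..} y * (y powr b * (2 * pi * (exp (- y * \<bar>of_int \<nu>\<bar>) - (if \<nu> = 0 then 1 else 0))))) \<partial>lborel)
    = (if \<nu> = 0 then 0 else complex_of_real (2 * pi * Gamma (b + 1) * \<bar>of_int \<nu>\<bar> powr (- (b + 1))))"
  proof (cases "\<nu> = 0")
    case False
    have "indicator {0<..} y * (y powr b * (2 * pi * (exp (- y * \<bar>of_int \<nu>\<bar>) - (if \<nu> = 0 then 1 else 0))))
      = 2 * pi * (indicator {0<..} y * (y powr (b + 1 - 1) * exp (- y * \<bar>of_int \<nu>\<bar>)))" for y
      using False by simp
    hence "(\<integral>y. indicator {0<..} y * (y powr b * (2 * pi * (exp (- y * \<bar>of_int \<nu>\<bar>) - (if \<nu> = 0 then 1 else 0)))) \<partial>lborel)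
      = 2 * pi * (Gamma (b + 1) * \<bar>of_int \<nu>\<bar> powr (- (b + 1)))"
      using integral_powr_exp_minus[OF a, of "\<bar>of_int \<nu>\<bar>"] False by (simp only: integral_mult_right_zero)
    thus ?thesis using False by (simp only: integral_complex_of_real if_False mult.assoc)
  qed simp
  finally show ?thesis by (simp add: b_def algebra_simps)
qed

text \<open>
  The sum of the series of the theorem, as a function defined everywhere.
\<close>

definition singular_function :: "real \<Rightarrow> real \<Rightarrow> real \<Rightarrow> complex" where
  "singular_function t p x = complex_of_real (riesz_kernel (t - 1 / p) x / (2 * Gamma (t + 1 - 1 / p)))"

lemma singular_function_has_cosine_series:
  assumes p: "1 < p" and t: "0 < t" "t < 1"
  shows "has_cosine_series (singular_function t p) (\<lambda>\<nu>. real \<nu> powr (- t - 1 + 1 / p))"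
  unfolding has_cosine_series_def
proof (intro conjI allI)
  interpret finite_measure circle_measure by (rule finite_measure_circle)
  interpret pair_sigma_finite circle_measure lborel ..
  define c where "c = 2 * Gamma (t + 1 - 1 / p)"
  have "1 / p < 1" using p by simp
  hence "0 < t + 1 - 1 / p" using t by linarith
  hence c: "c > 0" by (simp add: c_def Gamma_real_pos)
  have "integrable circle_measure (riesz_kernel (t - 1 / p))"
    using integrable_fst'[OF riesz_kernel_shift_Lp(1)[OF p t, of 0]] by (simp add: riesz_kernel_def[abs_def])
  hence "integrable circle_measure (\<lambda>x. \<bar>riesz_kernel (t - 1 / p) x\<bar> / c)" by simp
  hence "integrable circle_measure (\<lambda>x. norm (singular_function t p x) powr 1)"
    using c by (simp add: singular_function_def c_def[symmetric] norm_divide)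
  moreover have "singular_function t p \<in> borel_measurable lebesgue"
  proof -
    have "singular_function t p \<in> borel_measurable borel"
      unfolding singular_function_def[abs_def] by measurable
    thus ?thesis by (simp add: measurable_completion)
  qed
  ultimately show "singular_function t p \<in> Lp_circle 1"
    by (simp add: Lp_circle_def periodic_2pi_def singular_function_def riesz_kernel_periodic)
  fix \<nu> :: int
  have "fourier_coeff (singular_function t p) \<nu> = (\<integral>x. complex_of_real (1 / c) * (complex_of_real (riesz_kernel (t - 1 / p) x) * cis (- (of_int \<nu> * x))) \<partial>circle_measure) / complex_of_real (2 * pi)"
    by (simp add: fourier_coeff_def singular_function_def c_def)
  also have "\<dots> = complex_of_real (1 / c) * (if \<nu> = 0 then 0 else complex_of_real (pi * c * \<bar>of_int \<nu>\<bar> powr (- (t + 1 - 1 / p)))) / complex_of_real (2 * pi)"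
    unfolding integral_mult_right_zero riesz_kernel_fourier[OF p t] by (simp add: c_def)
  also have "\<dots> = (if \<nu> = 0 then 0 else complex_of_real (real (nat \<bar>\<nu>\<bar>) powr (- t - 1 + 1 / p) / 2))"
    using c by (simp add: algebra_simps)
  finally show "fourier_coeff (singular_function t p) \<nu> = (if \<nu> = 0 then 0 else complex_of_real (real (nat \<bar>\<nu>\<bar>) powr (- t - 1 + 1 / p) / 2))" .
qed

section \<open>Failure at the critical exponent\<close>

lemma Lp_circle_integrable:
  assumes g: "g \<in> Lp_circle p" and p: "1 < p"
  shows "integrable circle_measure g" "integrable circle_measure (\<lambda>x. norm (g x) powr p)" 
    "g \<in> borel_measurable circle_measure"
proof -
  interpret finite_measure circle_measure by (rule finite_measure_circle)
  show i: "integrable circle_measure (\<lambda>x. norm (g x) powr p)" using g by (simp add: Lp_circle_def)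
  have "g \<in> borel_measurable lebesgue" using g by (simp add: Lp_circle_def)
  thus m: "g \<in> borel_measurable circle_measure" by (rule measurable_restrict_space1)
  show "integrable circle_measure g"
    using le_one_plus_powr[OF p]
    by (intro Bochner_Integration.integrable_bound[OF Bochner_Integration.integrable_add[OF integrable_const[of 1] i] m]) auto
qed

text \<open>
  For \<open>y = 1 / N\<close>, the Poisson integral of \<open>g\<close> at 0 is the sum of the nonnegative terms
  \<open>2 * pi * exp (- n / N) * n powr (1 / p - 1)\<close>, and its first \<open>N\<close> terms already contribute at least
  \<open>2 * pi / e * N powr (1 / p)\<close>. Jensen's inequality bounds its \<open>p\<close>-th power by the Poisson integral
  of \<open>\<bar>g\<bar> powr p\<close>, whose quotient by \<open>N\<close> tends to 0 if \<open>\<bar>g\<bar> powr p\<close> is integrable: the kernel divided by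
  \<open>N\<close> is bounded and tends to 0 off the multiples of \<open>2 * pi\<close>. The formula for the coefficients
  includes \<open>\<nu> = 0\<close>, where it gives 0 because \<open>0 powr a = 0\<close>.
\<close>

lemma not_Lp_critical_cosine_series:
  fixes g :: "real \<Rightarrow> complex"
  assumes p: "1 < p" and g: "g \<in> Lp_circle p"
    and coeff: "\<And>\<nu>. fourier_coeff g \<nu> = complex_of_real (\<bar>real_of_int \<nu>\<bar> powr (1 / p - 1) / 2)"
  shows False
proof -
  define Y where "Y N = inverse (real (Suc N))" for N
  have Y: "0 < Y N" "Y \<longlonglongrightarrow> 0" for N unfolding Y_def by (simp, rule LIMSEQ_inverse_real_of_nat)
  note gi = Lp_circle_integrable[OF g p]
  note [measurable] = gi(3)
  define \<Phi> where "\<Phi> N x = Y N * (poisson (Y N) x * norm (g x) powr p)" for N x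
  have lower: "2 * pi * exp (- 1) * real (Suc N) powr (1 / p) \<le> (\<integral>x. poisson (Y N) x * norm (g x) \<partial>circle_measure)" for N
  proof -
    define u where "u n = 2 * pi * exp (- Y N) ^ n * real n powr (1 / p - 1)" for n
    have "(\<lambda>n. complex_of_real (u n)) sums (\<integral>x. g x * poisson (Y N) x \<partial>circle_measure)"
      using poisson_integral_sums[OF Y(1) gi(1), of N 0] by (simp add: coeff u_def)
    moreover from sums_Re[OF this] have s: "u sums Re (\<integral>x. g x * poisson (Y N) x \<partial>circle_measure)" by simp
    ultimately have "norm (\<integral>x. g x * poisson (Y N) x \<partial>circle_measure) \<ge> suminf u"
      using sums_unique[OF s] complex_Re_le_cmod by metis
    moreover have "suminf u \<ge> (\<Sum>n\<in>{1..Suc N}. u n)"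
    proof (rule sum_le_suminf)
      show "summable u" using s by (rule sums_summable)
    qed (auto simp: u_def)
    moreover have "(\<Sum>n\<in>{1..Suc N}. u n) \<ge> (\<Sum>n\<in>{1..Suc N}. 2 * pi * exp (- 1) * real (Suc N) powr (1 / p - 1))"
    proof (rule sum_mono)
      fix n assume n: "n \<in> {1..Suc N}"
      have "exp (- 1) \<le> exp (- Y N) ^ n"
        using n by (simp add: Y_def field_simps flip: exp_of_nat_mult)
      moreover have "real (Suc N) powr (1 / p - 1) \<le> real n powr (1 / p - 1)"
        using n p by (intro powr_mono2') (auto simp: field_simps)
      ultimately show "2 * pi * exp (- 1) * real (Suc N) powr (1 / p - 1) \<le> u n"
        unfolding u_def by (intro mult_mono) auto
    qed
    moreover have "(\<Sum>n\<in>{1..Suc N}. 2 * pi * exp (- 1) * real (Suc N) powr (1 / p - 1)) = 2 * pi * exp (- 1) * real (Suc N) powr (1 / p)"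
      using powr_mult_base[of "real (Suc N)" "1 / p - 1"] by simp
    moreover have "norm (\<integral>x. g x * poisson (Y N) x \<partial>circle_measure) \<le> (\<integral>x. norm (g x * poisson (Y N) x) \<partial>circle_measure)"
      by (rule integral_norm_bound)
    moreover have "(\<integral>x. norm (g x * poisson (Y N) x) \<partial>circle_measure) = (\<integral>x. poisson (Y N) x * norm (g x) \<partial>circle_measure)"
      using poisson_pos[OF Y(1)] by (intro Bochner_Integration.integral_cong) (auto simp: norm_mult less_imp_le)
    ultimately show ?thesis by linarith
  qed
  have i\<Phi>: "integrable circle_measure (\<lambda>x. poisson (Y N) x * norm (g x) powr p)" for N
  proof (rule Bochner_Integration.integrable_bound[OF integrable_mult_right[OF gi(2), of "1 + 2 / Y N"]])
    show "AE x in circle_measure. norm (poisson (Y N) x * norm (g x) powr p) \<le> norm ((1 + 2 / Y N) * norm (g x) powr p)"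
      using poisson_le[OF Y(1)] poisson_pos[OF Y(1), THEN less_imp_le] Y(1)[of N]
      by (auto simp: abs_mult intro!: AE_I2 mult_right_mono)
  qed measurable
  have low: "(2 * pi * exp (- 1)) powr p \<le> (2 * pi) powr (p - 1) * (\<integral>x. \<Phi> N x \<partial>circle_measure)" for N
  proof -
    have "(2 * pi * exp (- 1) * real (Suc N) powr (1 / p)) powr p \<le> (\<integral>x. poisson (Y N) x * norm (g x) \<partial>circle_measure) powr p"
      using lower[of N] p by (intro powr_mono2) auto
    also have "\<dots> \<le> (\<integral>x. poisson (Y N) x \<partial>circle_measure) powr (p - 1) * (\<integral>x. poisson (Y N) x * norm (g x) powr p \<partial>circle_measure)"
      using integral_poisson(1)[OF Y(1), of N 0] poisson_pos[OF Y(1), THEN less_imp_le] i\<Phi>[of N]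
      by (intro jensen_powr_integral(2)[OF p]) auto
    also have "(\<integral>x. poisson (Y N) x \<partial>circle_measure) = 2 * pi"
      using integral_poisson(2)[OF Y(1), of N 0] by simp
    also have "(2 * pi * exp (- 1) * real (Suc N) powr (1 / p)) powr p = (2 * pi * exp (- 1)) powr p * real (Suc N)"
      using p by (simp add: powr_mult powr_powr)
    finally have le: "(2 * pi * exp (- 1)) powr p * real (Suc N) \<le> (2 * pi) powr (p - 1) * (\<integral>x. poisson (Y N) x * norm (g x) powr p \<partial>circle_measure)" .
    have "(2 * pi * exp (- 1)) powr p = Y N * ((2 * pi * exp (- 1)) powr p * real (Suc N))"
      by (simp add: Y_def)
    also have "\<dots> \<le> Y N * ((2 * pi) powr (p - 1) * (\<integral>x. poisson (Y N) x * norm (g x) powr p \<partial>circle_measure))"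
      using Y(1)[of N] by (intro mult_left_mono le) auto
    also have "\<dots> = (2 * pi) powr (p - 1) * (Y N * (\<integral>x. poisson (Y N) x * norm (g x) powr p \<partial>circle_measure))"
      by (rule mult.left_commute)
    also have "Y N * (\<integral>x. poisson (Y N) x * norm (g x) powr p \<partial>circle_measure) = (\<integral>x. \<Phi> N x \<partial>circle_measure)"
      unfolding \<Phi>_def by (rule integral_mult_right_zero[symmetric])
    finally show ?thesis .
  qed
  have lim: "(\<lambda>N. (2 * pi) powr (p - 1) * (\<integral>x. \<Phi> N x \<partial>circle_measure)) \<longlonglongrightarrow> (2 * pi) powr (p - 1) * (\<integral>x. 0 \<partial>circle_measure)"
  proof (intro tendsto_mult_left integral_dominated_convergence[where w = "\<lambda>x. 3 * norm (g x) powr p"])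
    show "AE x in circle_measure. (\<lambda>N. \<Phi> N x) \<longlonglongrightarrow> 0"
      using AE_circle_neq[of 0] AE_circle_neq[of "2 * pi"] AE_space
    proof eventually_elim
      case (elim x)
      have c: "cos x < 1"
      proof -
        have "cos x \<noteq> 1"
        proof
          assume "cos x = 1"
          then obtain k :: int where k: "x = of_int k * 2 * pi" by (auto simp: cos_one_2pi_int)
          have "0 < x" "x < 2 * pi" using elim by auto
          hence "0 < real_of_int k" "real_of_int k < 1" using k by (auto simp: zero_less_mult_iff)
          thus False by simp
        qed
        thus ?thesis using cos_le_one[of x] by linarith
      qed
      have lim: "(\<lambda>N. Y N * (sinh (Y N) / (1 - cos x) * norm (g x) powr p)) \<longlonglongrightarrow> 0 * (sinh 0 / (1 - cos x) * norm (g x) powr p)"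
        using c by (intro tendsto_intros Y) auto
      show ?case
      proof (rule tendsto_sandwich[OF _ _ tendsto_const])
        show "\<forall>\<^sub>F N in sequentially. 0 \<le> \<Phi> N x"
          using Y(1) poisson_pos[OF Y(1)] by (auto simp: \<Phi>_def less_imp_le)
        show "\<forall>\<^sub>F N in sequentially. \<Phi> N x \<le> Y N * (sinh (Y N) / (1 - cos x) * norm (g x) powr p)"
          unfolding \<Phi>_def using Y(1) poisson_le_off_diagonal[OF Y(1) order_refl c]
          by (intro always_eventually allI mult_left_mono mult_right_mono) (auto simp: less_imp_le)
      qed (use lim in simp)
    qed
    show "AE x in circle_measure. norm (\<Phi> N x) \<le> 3 * norm (g x) powr p" for N
    proof (rule AE_I2)
      fix x
      have "Y N * poisson (Y N) x \<le> Y N * (1 + 2 / Y N)"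
        using Y(1)[of N] poisson_le[OF Y(1)] by (intro mult_left_mono) (auto simp: less_imp_le)
      also have "\<dots> = Y N + 2" using Y(1)[of N] by (simp add: distrib_left)
      also have "\<dots> \<le> 3" by (simp add: Y_def inverse_le_1_iff)
      finally have "Y N * poisson (Y N) x * norm (g x) powr p \<le> 3 * norm (g x) powr p"
        by (intro mult_right_mono) auto
      thus "norm (\<Phi> N x) \<le> 3 * norm (g x) powr p"
        using Y(1)[of N] poisson_pos[OF Y(1), of N x] by (simp add: \<Phi>_def abs_mult mult_ac)
    qed
    show "\<Phi> N \<in> borel_measurable circle_measure" for N unfolding \<Phi>_def by measurable
  qed (use gi(2) in auto)
  have "(2 * pi * exp (- 1)) powr p \<le> (2 * pi) powr (p - 1) * (\<integral>x. 0 \<partial>circle_measure)"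
    by (rule LIMSEQ_le_const[OF lim]) (intro exI allI impI low)
  thus False by (simp add: not_le)
qed

section \<open>The Gagliardo seminorm\<close>

text \<open>
  The exceptional set of two periodic functions is a countable union of translates of its part in one
  period.
\<close>

lemma AE_circle_shift:
  assumes f: "periodic_2pi f" and g: "periodic_2pi g" and eq: "AE x in circle_measure. f x = g x"
  shows "AE x in circle_measure. f (x + h) = g (x + h)"
proof -
  define E where "E = {x. f x \<noteq> g x}"
  define c where "c k = of_int k * (2 * pi)" for k :: int
  have per: "u (x + c k) = u x" if "periodic_2pi u" for u x k
  proof -
    have "u (x + real n * (2 * pi)) = u x" for n x
      using that by (induction n) (simp_all add: periodic_2pi_def algebra_simps, metis add.assoc add.commute)
    from this[of x "nat k"] this[of "x + c k" "nat (- k)"] show ?thesis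
      by (cases "0 \<le> k") (auto simp: c_def)
  qed
  have "AE x in lebesgue. x \<in> {0..2*pi} \<longrightarrow> f x = g x"
    using eq by (subst (asm) AE_restrict_space_iff) auto
  hence "{x \<in> space lebesgue. \<not> (x \<in> {0..2*pi} \<longrightarrow> f x = g x)} \<in> null_sets lebesgue"
    by (simp only: completion.AE_iff_null_sets)
  hence neg: "negligible (E \<inter> {0..2*pi})"
    by (simp add: negligible_iff_null_sets E_def Int_def conj_commute)
  have "E \<subseteq> (\<Union>k. (+) (c k) ` (E \<inter> {0..2*pi}))"
  proof
    fix x assume x: "x \<in> E"
    define k where "k = \<lfloor>x / (2 * pi)\<rfloor>"
    have "of_int k \<le> x / (2 * pi)" "x / (2 * pi) < of_int k + 1" unfolding k_def by linarith+
    hence "x - c k \<in> {0..2*pi}" by (simp add: c_def field_simps)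
    moreover have "x - c k \<in> E" using per[OF f, of "x - c k" k] per[OF g, of "x - c k" k] x by (simp add: E_def)
    ultimately have "x \<in> (+) (c k) ` (E \<inter> {0..2*pi})" by (intro image_eqI[of _ _ "x - c k"]) auto
    thus "x \<in> (\<Union>k. (+) (c k) ` (E \<inter> {0..2*pi}))" by blast
  qed
  moreover have "negligible (\<Union>k. (+) (c k) ` (E \<inter> {0..2*pi}))"
    by (rule negligible_countable_Union) (auto intro!: negligible_translation neg)
  ultimately have "negligible E" by (rule negligible_subset[rotated])
  hence "negligible ((+) (- h) ` E)" by (rule negligible_translation)
  hence "AE x in lebesgue. x \<notin> (+) (- h) ` E"
    by (intro AE_not_in) (simp add: negligible_iff_null_sets)
  hence "AE x in lebesgue. f (x + h) = g (x + h)"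
  proof eventually_elim
    case (elim x)
    hence "x + h \<notin> E" by (auto simp: image_iff)
    thus ?case by (simp add: E_def)
  qed
  thus ?thesis by (subst AE_restrict_space_iff) auto
qed

lemma powr_add_le:
  fixes a b p :: real
  assumes "0 \<le> a" "0 \<le> b" "0 < p"
  shows "(a + b) powr p \<le> 2 powr p * (a powr p + b powr p)"
proof -
  have "(a + b) powr p \<le> (2 * max a b) powr p" using assms by (intro powr_mono2) auto
  also have "\<dots> = 2 powr p * max a b powr p" using assms by (simp add: powr_mult)
  also have "\<dots> \<le> 2 powr p * (a powr p + b powr p)"
    by (intro mult_left_mono) (auto simp: max_def)
  finally show ?thesis .
qed

text \<open>
  Near \<open>h = 0\<close> the integrand is of order \<open>\<bar>h\<bar> powr ((t - s) * p - 1)\<close>, and its integral produces the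
  factor \<open>1 / (t - s)\<close>; for \<open>\<bar>h\<bar> \<ge> 1\<close> the trivial bound suffices and produces \<open>1 / s\<close>.
\<close>

lemma gagliardo_seminorm_le_of_Lp_modulus:
  assumes p: "0 < p" and s: "0 < s" "s < t" and A: "0 \<le> A" and B: "0 \<le> B"
    and small: "\<And>h. h \<noteq> 0 \<Longrightarrow> \<bar>h\<bar> \<le> 1 \<Longrightarrow> 
      (\<integral>\<^sup>+x. ennreal (norm (f (x + h) - f x) powr p) \<partial>circle_measure) \<le> ennreal (A * \<bar>h\<bar> powr (t * p))"
    and large: "\<And>h. (\<integral>\<^sup>+x. ennreal (norm (f (x + h) - f x) powr p) \<partial>circle_measure) \<le> ennreal B"
    and meas [measurable]: "f \<in> borel_measurable borel"
  shows "gagliardo_seminorm s p f \<le> ennreal ((2 * (A / ((t - s) * p) + B / (s * p))) powr (1 / p))"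
proof -
  define I where "I = (\<integral>\<^sup>+h. (\<integral>\<^sup>+x. ennreal (norm (f (x + h) - f x) powr p / \<bar>h\<bar> powr (s * p + 1)) \<partial>circle_measure) \<partial>lebesgue)"
  \<comment> \<open>The bound as a function on the half-line; the inner integral at \<open>h\<close> is at most \<open>\<psi> \<bar>h\<bar>\<close>.\<close>
  define \<psi> where "\<psi> h = A * (indicator {0..1} h * h powr ((t - s) * p - 1)) + B * (indicator {1..} h * h powr (- (s * p) - 1))" for h :: real
  have [measurable]: "\<psi> \<in> borel_measurable borel" unfolding \<psi>_def by measurable
  have \<psi>0: "0 \<le> \<psi> h" for h unfolding \<psi>_def using A B by auto
  define K where "K = A / ((t - s) * p) + B / (s * p)"
  have K: "0 \<le> K" using A B s p by (simp add: K_def)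
  have sp: "0 < s * p" "0 < (t - s) * p" using s p by auto
  have i1: "(\<integral>\<^sup>+h. ennreal (indicator {0..1} h * h powr ((t - s) * p - 1)) \<partial>lborel) = ennreal (1 / ((t - s) * p))"
    using sp has_integral_powr_from_0[of "(t - s) * p - 1" 1]
    by (intro nn_integral_has_integral_lebesgue) auto
  have i2: "(\<integral>\<^sup>+h. ennreal (indicator {1..} h * h powr (- (s * p) - 1)) \<partial>lborel) = ennreal (1 / (s * p))"
    using sp has_integral_powr_to_inf[of "- (s * p) - 1" 1]
    by (intro nn_integral_has_integral_lebesgue) auto
  have \<psi>i: "(\<integral>\<^sup>+h. ennreal (\<psi> h) \<partial>lborel) = ennreal K"
  proof -
    have "(\<integral>\<^sup>+h. ennreal (\<psi> h) \<partial>lborel) = (\<integral>\<^sup>+h. ennreal A * ennreal (indicator {0..1} h * h powr ((t - s) * p - 1)) + ennreal B * ennreal (indicator {1..} h * h powr (- (s * p) - 1)) \<partial>lborel)"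
      using A B by (intro nn_integral_cong) (simp add: \<psi>_def ennreal_mult')
    also have "\<dots> = ennreal A * ennreal (1 / ((t - s) * p)) + ennreal B * ennreal (1 / (s * p))"
      by (subst nn_integral_add) (auto simp: nn_integral_cmult i1 i2)
    also have "\<dots> = ennreal K"
      using A B sp by (simp add: K_def flip: ennreal_mult ennreal_plus)
    finally show ?thesis .
  qed
  have "I \<le> (\<integral>\<^sup>+h. ennreal (\<psi> h + \<psi> (- h)) \<partial>lebesgue)"
    unfolding I_def
  proof (rule nn_integral_mono)
    fix h :: real
    define N where "N = (\<integral>\<^sup>+x. ennreal (norm (f (x + h) - f x) powr p) \<partial>circle_measure)"
    define D where "D = \<bar>h\<bar> powr (s * p + 1)"
    have "(\<integral>\<^sup>+x. ennreal (norm (f (x + h) - f x) powr p / D) \<partial>circle_measure) = (\<integral>\<^sup>+x. ennreal (1 / D) * ennreal (norm (f (x + h) - f x) powr p) \<partial>circle_measure)"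
      by (intro nn_integral_cong) (simp add: D_def flip: ennreal_mult)
    also have "\<dots> = ennreal (1 / D) * N"
      unfolding N_def by (intro nn_integral_cmult) measurable
    also have "\<dots> \<le> ennreal (\<psi> h + \<psi> (- h))"
    proof (cases "h = 0")
      case True
      thus ?thesis by (simp add: D_def)
    next
      case False
      define r where "r = \<bar>h\<bar>"
      have r: "0 < r" using False by (simp add: r_def)
      have \<psi>r: "\<psi> r \<le> \<psi> h + \<psi> (- h)" using \<psi>0[of h] \<psi>0[of "- h"] by (auto simp: r_def abs_if)
      have "ennreal (1 / D) * N \<le> ennreal (\<psi> r)"
      proof (cases "r \<le> 1")
        case True
        have "ennreal (1 / D) * N \<le> ennreal (1 / D) * ennreal (A * r powr (t * p))"
          unfolding N_def r_def using small[OF False] True by (intro mult_left_mono) (auto simp: r_def)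
        also have "\<dots> = ennreal (A * (r powr (t * p) / r powr (s * p + 1)))"
          by (subst ennreal_mult'[symmetric]) (auto simp: D_def r_def)
        also have "r powr (t * p) / r powr (s * p + 1) = r powr ((t - s) * p - 1)"
          by (simp add: algebra_simps flip: powr_diff)
        also have "ennreal (A * r powr ((t - s) * p - 1)) \<le> ennreal (\<psi> r)"
          using True r B by (intro ennreal_leI) (auto simp: \<psi>_def)
        finally show ?thesis .
      next
        case False
        have "ennreal (1 / D) * N \<le> ennreal (1 / D) * ennreal B"
          unfolding N_def by (intro mult_left_mono large) auto
        also have "\<dots> = ennreal (B * (1 / D))"
          by (subst ennreal_mult'[symmetric]) (auto simp: D_def)
        also have "ennreal (B * (1 / D)) = ennreal (B * r powr (- (s * p) - 1))"
          using powr_minus_divide[of r "s * p + 1"] by (simp add: D_def r_def)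
        also have "ennreal (B * r powr (- (s * p) - 1)) \<le> ennreal (\<psi> r)"
          using False r A by (intro ennreal_leI) (auto simp: \<psi>_def)
        finally show ?thesis .
      qed
      also have "\<dots> \<le> ennreal (\<psi> h + \<psi> (- h))" by (intro ennreal_leI \<psi>r)
      finally show ?thesis .
    qed
    finally show "(\<integral>\<^sup>+x. ennreal (norm (f (x + h) - f x) powr p / \<bar>h\<bar> powr (s * p + 1)) \<partial>circle_measure) \<le> ennreal (\<psi> h + \<psi> (- h))"
      by (simp add: D_def)
  qed
  also have "\<dots> = (\<integral>\<^sup>+h. ennreal (\<psi> h) + ennreal (\<psi> (- h)) \<partial>lborel)"
    by (subst nn_integral_completion) (simp add: \<psi>0)
  also have "\<dots> = ennreal K + ennreal K"
    using nn_integral_real_affine[of "\<lambda>h. ennreal (\<psi> h)" "- 1" 0] by (subst nn_integral_add) (auto simp: \<psi>i)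
  also have "\<dots> = ennreal (2 * K)" using K by (simp flip: ennreal_plus)
  finally have I: "I \<le> ennreal (2 * K)" .
  have "I \<noteq> \<infinity>" using I by (auto simp: top_unique)
  moreover have "enn2real I \<le> 2 * K" using I K by (intro enn2real_leI) auto
  hence "enn2real I powr (1 / p) \<le> (2 * K) powr (1 / p)" using p by (intro powr_mono2) auto
  ultimately show ?thesis
    unfolding gagliardo_seminorm_def I_def[symmetric] ennreal_powr_def K_def[symmetric] by (simp add: ennreal_leI)
qed

lemma nn_integral_singular_function_diff:
  assumes p: "1 < p" and t: "0 < t" "t < 1"
  defines "c \<equiv> 2 * Gamma (t + 1 - 1 / p)"
  shows "(\<integral>\<^sup>+x. ennreal (norm (singular_function t p (x + h) - singular_function t p x) powr p) \<partial>circle_measure)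
    = ennreal (1 / c powr p) * (\<integral>\<^sup>+x. ennreal (\<bar>riesz_kernel (t - 1 / p) (x + h) - riesz_kernel (t - 1 / p) x\<bar> powr p) \<partial>circle_measure)"
    and "(\<integral>\<^sup>+x. ennreal (norm (singular_function t p x) powr p) \<partial>circle_measure)
    = ennreal (1 / c powr p) * (\<integral>\<^sup>+x. ennreal (\<bar>riesz_kernel (t - 1 / p) x\<bar> powr p) \<partial>circle_measure)"
proof -
  have "1 / p < 1" using p by simp
  hence "0 < t + 1 - 1 / p" using t by linarith
  hence c: "0 < c" by (simp add: c_def Gamma_real_pos)
  have c0: "0 \<le> 1 / c powr p" by simp
  have n: "norm (singular_function t p (x + h) - singular_function t p x) powr p = 1 / c powr p * \<bar>riesz_kernel (t - 1 / p) (x + h) - riesz_kernel (t - 1 / p) x\<bar> powr p"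
    "norm (singular_function t p x) powr p = 1 / c powr p * \<bar>riesz_kernel (t - 1 / p) x\<bar> powr p" for x
  proof -
    have "norm (singular_function t p (x + h) - singular_function t p x) = \<bar>riesz_kernel (t - 1 / p) (x + h) - riesz_kernel (t - 1 / p) x\<bar> / c"
      using c unfolding singular_function_def c_def[symmetric]
      by (subst of_real_diff[symmetric], subst norm_of_real) (simp flip: diff_divide_distrib)
    thus "norm (singular_function t p (x + h) - singular_function t p x) powr p = 1 / c powr p * \<bar>riesz_kernel (t - 1 / p) (x + h) - riesz_kernel (t - 1 / p) x\<bar> powr p"
      using c by (simp add: powr_divide)
    have "norm (singular_function t p x) = \<bar>riesz_kernel (t - 1 / p) x\<bar> / c"
      using c unfolding singular_function_def c_def[symmetric] by (subst norm_of_real) simp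
    thus "norm (singular_function t p x) powr p = 1 / c powr p * \<bar>riesz_kernel (t - 1 / p) x\<bar> powr p"
      using c by (simp add: powr_divide)
  qed
  show "(\<integral>\<^sup>+x. ennreal (norm (singular_function t p (x + h) - singular_function t p x) powr p) \<partial>circle_measure)
    = ennreal (1 / c powr p) * (\<integral>\<^sup>+x. ennreal (\<bar>riesz_kernel (t - 1 / p) (x + h) - riesz_kernel (t - 1 / p) x\<bar> powr p) \<partial>circle_measure)"
    unfolding n ennreal_mult'[OF c0] by (rule nn_integral_cmult) measurable
  show "(\<integral>\<^sup>+x. ennreal (norm (singular_function t p x) powr p) \<partial>circle_measure)
    = ennreal (1 / c powr p) * (\<integral>\<^sup>+x. ennreal (\<bar>riesz_kernel (t - 1 / p) x\<bar> powr p) \<partial>circle_measure)"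
    unfolding n ennreal_mult'[OF c0] by (rule nn_integral_cmult) measurable
qed

lemma singular_function_measurable [measurable]: "singular_function t p \<in> borel_measurable borel"
  unfolding singular_function_def[abs_def] by measurable

lemma singular_function_Lp_modulus:
  assumes p: "1 < p" and t: "0 < t" "t < 1"
  obtains A B where "0 \<le> A" "0 \<le> B"
    "\<And>h. h \<noteq> 0 \<Longrightarrow> (\<integral>\<^sup>+x. ennreal (norm (singular_function t p (x + h) - singular_function t p x) powr p) \<partial>circle_measure) \<le> ennreal (A * \<bar>h\<bar> powr (t * p))"
    "\<And>h. (\<integral>\<^sup>+x. ennreal (norm (singular_function t p (x + h) - singular_function t p x) powr p) \<partial>circle_measure) \<le> ennreal B"
proof
  define c where "c = 2 * Gamma (t + 1 - 1 / p)"
  define C where "C = 1 / t + 1 / (1 - t)"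
  define L where "L = 4 * pi * (4 * C) powr p"
  define R where "R = riesz_kernel (t - 1 / p)"
  have [measurable]: "R \<in> borel_measurable borel" unfolding R_def by measurable
  have L: "0 \<le> L" by (simp add: L_def)
  have C: "0 \<le> C" using t by (simp add: C_def)
  note eq = nn_integral_singular_function_diff(1)[OF p t, folded c_def R_def]
  show "0 \<le> 1 / c powr p * (4 * pi * (24 * C) powr p)" by simp
  show "0 \<le> 1 / c powr p * (2 powr p * (2 * L))" using L by simp
  fix h :: real
  {
    assume h: "h \<noteq> 0"
    have "(\<integral>\<^sup>+x. ennreal (norm (singular_function t p (x + h) - singular_function t p x) powr p) \<partial>circle_measure)
        \<le> ennreal (1 / c powr p) * ennreal (4 * pi * (24 * C * \<bar>h\<bar> powr t) powr p)"
      unfolding eq C_def R_def by (intro mult_left_mono riesz_kernel_increment_Lp p t h) auto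
    also have "\<dots> = ennreal (1 / c powr p * (4 * pi * (24 * C) powr p) * \<bar>h\<bar> powr (t * p))"
      using C by (subst ennreal_mult'[symmetric]) (auto simp: powr_mult powr_powr)
    finally show "(\<integral>\<^sup>+x. ennreal (norm (singular_function t p (x + h) - singular_function t p x) powr p) \<partial>circle_measure)
        \<le> ennreal (1 / c powr p * (4 * pi * (24 * C) powr p) * \<bar>h\<bar> powr (t * p))" .
  }
  have RL: "(\<integral>\<^sup>+x. ennreal (\<bar>R (x + h)\<bar> powr p) \<partial>circle_measure) \<le> ennreal L" for h
    using riesz_kernel_shift_Lp(3)[OF p t, of h] by (simp add: R_def L_def C_def)
  have "(\<integral>\<^sup>+x. ennreal (\<bar>R (x + h) - R x\<bar> powr p) \<partial>circle_measure)
      \<le> (\<integral>\<^sup>+x. ennreal (2 powr p) * (ennreal (\<bar>R (x + h)\<bar> powr p) + ennreal (\<bar>R (x + 0)\<bar> powr p)) \<partial>circle_measure)"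
  proof (rule nn_integral_mono)
    fix x
    have "\<bar>R (x + h) - R x\<bar> powr p \<le> (\<bar>R (x + h)\<bar> + \<bar>R x\<bar>) powr p"
      using p by (intro powr_mono2) auto
    also have "\<dots> \<le> 2 powr p * (\<bar>R (x + h)\<bar> powr p + \<bar>R x\<bar> powr p)"
      using p by (intro powr_add_le) auto
    finally show "ennreal (\<bar>R (x + h) - R x\<bar> powr p) \<le> ennreal (2 powr p) * (ennreal (\<bar>R (x + h)\<bar> powr p) + ennreal (\<bar>R (x + 0)\<bar> powr p))"
      by (simp add: ennreal_leI flip: ennreal_plus ennreal_mult')
  qed
  also have "\<dots> = ennreal (2 powr p) * ((\<integral>\<^sup>+x. ennreal (\<bar>R (x + h)\<bar> powr p) \<partial>circle_measure) + (\<integral>\<^sup>+x. ennreal (\<bar>R (x + 0)\<bar> powr p) \<partial>circle_measure))"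
    by (subst nn_integral_cmult, measurable, subst nn_integral_add, measurable)
  also have "\<dots> \<le> ennreal (2 powr p) * (ennreal L + ennreal L)"
    by (intro mult_left_mono add_mono RL) auto
  also have "\<dots> = ennreal (2 powr p * (2 * L))"
    using L by (simp flip: ennreal_plus ennreal_mult')
  finally have "ennreal (1 / c powr p) * (\<integral>\<^sup>+x. ennreal (\<bar>R (x + h) - R x\<bar> powr p) \<partial>circle_measure) \<le> ennreal (1 / c powr p) * ennreal (2 powr p * (2 * L))"
    by (intro mult_left_mono) auto
  also have "\<dots> = ennreal (1 / c powr p * (2 powr p * (2 * L)))" by (rule ennreal_mult'[symmetric]) simp
  finally show "(\<integral>\<^sup>+x. ennreal (norm (singular_function t p (x + h) - singular_function t p x) powr p) \<partial>circle_measure)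
      \<le> ennreal (1 / c powr p * (2 powr p * (2 * L)))" unfolding eq .
qed

lemma cosine_series_AE_unique:
  assumes f: "has_cosine_series f a" and g: "has_cosine_series g a"
  shows "AE x in circle_measure. f x = g x"
proof -
  have int: "integrable circle_measure u" if "has_cosine_series u a" for u
  proof -
    from that have u: "integrable circle_measure (\<lambda>x. norm (u x) powr 1)" "u \<in> borel_measurable lebesgue"
      by (auto simp: has_cosine_series_def Lp_circle_def)
    thus ?thesis
      by (intro Bochner_Integration.integrable_bound[OF u(1)] measurable_restrict_space1) auto
  qed
  have cis: "integrable circle_measure (\<lambda>x. u x * cis (- (of_int \<nu> * x)))" if "has_cosine_series u a" for u \<nu>
    by (intro integrable_bounded_mult[OF int[OF that], where B = 1]) auto
  have "fourier_coeff (\<lambda>x. f x - g x) \<nu> = fourier_coeff f \<nu> - fourier_coeff g \<nu>" for \<nu>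
    using cis[OF f, of \<nu>] cis[OF g, of \<nu>] by (simp add: fourier_coeff_def left_diff_distrib diff_divide_distrib)
  also have "fourier_coeff f \<nu> - fourier_coeff g \<nu> = 0" for \<nu>
    using f g by (simp add: has_cosine_series_def)
  finally have "fourier_coeff (\<lambda>x. f x - g x) \<nu> = 0" for \<nu> .
  from fourier_coeff_eq_0_imp_AE_eq_0[OF Bochner_Integration.integrable_diff[OF int[OF f] int[OF g]] this]
  show ?thesis by simp
qed

theorem proposition3p1:
  fixes p t :: real
  assumes "1 < p" and "0 < t" and "t < 1"
  shows "(\<exists>f. has_cosine_series f (\<lambda>\<nu>. real \<nu> powr (- t - 1 + 1 / p))) \<and>
    (\<forall>f. has_cosine_series f (\<lambda>\<nu>. real \<nu> powr (- t - 1 + 1 / p)) \<longrightarrow>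
      f \<in> Lp_circle p \<and> f \<notin> H_circle t p \<and>
      (\<forall>s :: nat \<Rightarrow> real.
        (\<forall>k. 0 < s k \<and> s k < t) \<and> incseq s \<and> s \<longlonglongrightarrow> t \<longrightarrow>
        (SUP k. ennreal ((t - s k) powr (1 / p)) * gagliardo_seminorm (s k) p f) < \<infinity>))"
proof (intro conjI allI impI)
  note p = assms(1) and t = assms(2,3)
  define f0 where "f0 = singular_function t p"
  have f0: "has_cosine_series f0 (\<lambda>\<nu>. real \<nu> powr (- t - 1 + 1 / p))"
    unfolding f0_def by (rule singular_function_has_cosine_series[OF p t])
  show "\<exists>f. has_cosine_series f (\<lambda>\<nu>. real \<nu> powr (- t - 1 + 1 / p))" using f0 by blast
  fix f assume f: "has_cosine_series f (\<lambda>\<nu>. real \<nu> powr (- t - 1 + 1 / p))"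
  have eq: "AE x in circle_measure. f x = f0 x" by (rule cosine_series_AE_unique[OF f f0])
  have per: "periodic_2pi f" "periodic_2pi f0"
    using f f0 by (auto simp: has_cosine_series_def Lp_circle_def)
  have fm: "f \<in> borel_measurable lebesgue" using f by (simp add: has_cosine_series_def Lp_circle_def)
  have f0m [measurable]: "f0 \<in> borel_measurable borel" unfolding f0_def by measurable
  have "integrable circle_measure (\<lambda>x. norm (f0 x) powr p)"
  proof (rule integrableI_nonneg)
    have "(\<integral>\<^sup>+x. ennreal (\<bar>riesz_kernel (t - 1 / p) x\<bar> powr p) \<partial>circle_measure) < \<infinity>"
      using riesz_kernel_shift_Lp(3)[OF p t, of 0] by (simp add: le_less_trans)
    thus "(\<integral>\<^sup>+x. ennreal (norm (f0 x) powr p) \<partial>circle_measure) < \<infinity>"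
      unfolding f0_def nn_integral_singular_function_diff(2)[OF p t] by (simp add: ennreal_mult_less_top)
  qed auto
  moreover have "(\<lambda>x. norm (f x) powr p) \<in> borel_measurable circle_measure"
    using measurable_restrict_space1[OF fm] by measurable
  ultimately have "integrable circle_measure (\<lambda>x. norm (f x) powr p)"
    using eq by (subst integrable_cong_AE[where g = "\<lambda>x. norm (f0 x) powr p"]) auto
  thus "f \<in> Lp_circle p" using per fm by (simp add: Lp_circle_def)
  show "f \<notin> H_circle t p"
  proof
    assume "f \<in> H_circle t p"
    then obtain g where g: "g \<in> Lp_circle p" "is_frac_laplacian t f g" by (auto simp: H_circle_def)
    have "fourier_coeff g \<nu> = complex_of_real (\<bar>real_of_int \<nu>\<bar> powr (1 / p - 1) / 2)" for \<nu>
    proof (cases "\<nu> = 0")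
      case False
      hence "fourier_coeff g \<nu> = complex_of_real (\<bar>real_of_int \<nu>\<bar> powr t * \<bar>real_of_int \<nu>\<bar> powr (- t - 1 + 1 / p) / 2)"
        using f g(2) by (simp add: is_frac_laplacian_def has_cosine_series_def)
      also have "\<bar>real_of_int \<nu>\<bar> powr t * \<bar>real_of_int \<nu>\<bar> powr (- t - 1 + 1 / p) = \<bar>real_of_int \<nu>\<bar> powr (1 / p - 1)"
        by (simp flip: powr_add)
      finally show ?thesis .
    qed (use g(2) in \<open>simp add: is_frac_laplacian_def\<close>)
    with not_Lp_critical_cosine_series[OF p g(1)] show False by blast
  qed
  fix s :: "nat \<Rightarrow> real"
  assume "(\<forall>k. 0 < s k \<and> s k < t) \<and> incseq s \<and> s \<longlonglongrightarrow> t"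
  hence s: "0 < s k" "s k < t" "s 0 \<le> s k" for k by (auto simp: incseq_def)
  \<comment> \<open>The seminorm does not see null sets, so it suffices to treat the explicit representative.\<close>
  have gag: "gagliardo_seminorm s p f = gagliardo_seminorm s p f0" for s
  proof -
    have "(\<integral>\<^sup>+x. ennreal (norm (f (x + h) - f x) powr p / \<bar>h\<bar> powr (s * p + 1)) \<partial>circle_measure)
      = (\<integral>\<^sup>+x. ennreal (norm (f0 (x + h) - f0 x) powr p / \<bar>h\<bar> powr (s * p + 1)) \<partial>circle_measure)" for h
    proof (rule nn_integral_cong_AE)
      show "AE x in circle_measure. ennreal (norm (f (x + h) - f x) powr p / \<bar>h\<bar> powr (s * p + 1))
        = ennreal (norm (f0 (x + h) - f0 x) powr p / \<bar>h\<bar> powr (s * p + 1))"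
        using eq AE_circle_shift[OF per eq, of h] by eventually_elim simp
    qed
    thus ?thesis by (simp add: gagliardo_seminorm_def)
  qed
  obtain A B where AB: "0 \<le> A" "0 \<le> B"
    "\<And>h. h \<noteq> 0 \<Longrightarrow> (\<integral>\<^sup>+x. ennreal (norm (f0 (x + h) - f0 x) powr p) \<partial>circle_measure) \<le> ennreal (A * \<bar>h\<bar> powr (t * p))"
    "\<And>h. (\<integral>\<^sup>+x. ennreal (norm (f0 (x + h) - f0 x) powr p) \<partial>circle_measure) \<le> ennreal B"
    using singular_function_Lp_modulus[OF p t] unfolding f0_def by blast
  \<comment> \<open>As \<open>s\<close> increases, \<open>s 0 > 0\<close> bounds all \<open>s k\<close> from below and \<open>1 / s k\<close> stays bounded.\<close>
  define M where "M = (2 * (A / p + t * (B / (s 0 * p)))) powr (1 / p)"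
  have "ennreal ((t - s k) powr (1 / p)) * gagliardo_seminorm (s k) p f \<le> ennreal M" for k
  proof -
    define K where "K = A / ((t - s k) * p) + B / (s k * p)"
    have K: "0 \<le> K" using AB s[of k] p by (simp add: K_def)
    have "ennreal ((t - s k) powr (1 / p)) * gagliardo_seminorm (s k) p f \<le> ennreal ((t - s k) powr (1 / p)) * ennreal ((2 * K) powr (1 / p))"
      unfolding gag K_def using AB s[of k] p
      by (intro mult_left_mono gagliardo_seminorm_le_of_Lp_modulus f0m) auto
    also have "\<dots> = ennreal (((t - s k) * (2 * K)) powr (1 / p))"
      using s[of k] K by (simp add: powr_mult flip: ennreal_mult')
    also have "\<dots> \<le> ennreal M"
    proof -
      have "(t - s k) * K = A / p + (t - s k) * (B / (s k * p))"
        using s[of k] p by (simp add: K_def distrib_left)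
      also have "\<dots> \<le> A / p + t * (B / (s 0 * p))"
        using s[of k] s[of 0] AB p t by (intro add_left_mono mult_mono divide_left_mono mult_right_mono) auto
      finally have "(t - s k) * (2 * K) \<le> 2 * (A / p + t * (B / (s 0 * p)))" by simp
      thus ?thesis unfolding M_def using s[of k] K p by (intro ennreal_leI powr_mono2) auto
    qed
    finally show ?thesis .
  qed
  hence "(SUP k. ennreal ((t - s k) powr (1 / p)) * gagliardo_seminorm (s k) p f) \<le> ennreal M"
    by (intro SUP_least) auto
  thus "(SUP k. ennreal ((t - s k) powr (1 / p)) * gagliardo_seminorm (s k) p f) < \<infinity>"
    by (simp add: le_less_trans)
qed

end
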